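(* Let $G$ be a totally nonabelian Carnot group, with finest direct product decomposition $G^1\times\dots\times G^m$, where $m>1$. Suppose that $G^j$ is tight for each $j=1,\dots,m$. Let $f:G\to G$ be a CR mapping. Then $f$ is the composition of a group automorphism that permutes the groups $G^j$ and a product CR mapping; that is, there are a group automorphism $T$ of $G$ that permutes the groups $G^j$ and a CR mapping $F:G\to G$ of the form $F(p^1,\dots,p^m)=(f^1(p^1),\dots,f^m(p^m))$ with $f^j:G^j\to G^j$, such that $f=T\circ F$.
   Context: A real finite-dimensional Lie algebra $\mathfrak{g}$ (of dimension at least $3$) is stratified of step $\ell$ if $\mathfrak{g}=\mathfrak{g}_{-1}\oplus\cdots\oplus\mathfrak{g}_{-\ell}$, where $[\mathfrak{g}_{-j},\mathfrak{g}_{-1}]=\mathfrak{g}_{-j-1}$ for $1\le j\le\ell$, $\mathfrak{g}_{-\ell}\ne\{0\}$ and $\mathfrak{g}_{-\ell-1}=\{0\}$. A stratified group $G$ is a connected simply connected Lie group with stratified Lie algebra $\mathfrak{g}$; $\exp:\mathfrak{g}\to G$ is a bijection with inverse $\log$. For $s>0$ the dilation $\delta_s$ acts as $s^j$ on $\mathfrak{g}_{-j}$; also write $\delta_s=\exp\circ\,\delta_s\circ\log$ on $G$. $\mathrm{Aut}^\delta(\mathfrak{g})$ (respectively $\mathrm{Aut}^\delta(G)$) is the group of automorphisms commuting with dilations. A Carnot group is a stratified group equipped with the left-invariant sub-Riemannian distance determined by a scalar product on $\mathfrak{g}_{-1}$. $G$ is totally nonabelian if $\mathfrak{g}_{-1}$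 meets the centre of $\mathfrak{g}$ only in $0$. In that case $\mathfrak{g}$ has a finest direct sum decomposition $\mathfrak{g}=\bigoplus_{k=1}^m\mathfrak{g}^k$ into nontrivial, pairwise commuting, totally nonabelian stratified Lie algebras, characterised by: for any direct sum decomposition $\mathfrak{g}=\bigoplus_l\tilde{\mathfrak{g}}^l$ into ideals, $\{1,\dots,m\}$ is partitioned into sets $J_l$ with $\tilde{\mathfrak{g}}^l=\bigoplus_{j\in J_l}\mathfrak{g}^j$. The corresponding decomposition $G=G^1\times\dots\times G^m$ is the finest direct product decomposition of $G$. A stratified group is tight if it is totally nonabelian, its finest direct product decomposition has only one factor, and the second layer of its Lie algebra has dimension $1$. Equivalently, its first layer has a basis $X_1,\dots,X_r,Y_1,\dots,Y_r$ and its second layer is $\mathrm{span}\{U\}$, with $[X_j,X_l]=[Y_j,Y_l]=0$ and $[X_j,Y_l]=\delta_{jl}U$. Fixing such a basis, its almost complex structure is the linear map $J$ of the first layer with $JX_j=Y_j$, $JY_j=-X_j$. On the product $G=G^1\times\dots\times G^m$ of tight groups, $J:\mathfrak{g}_{-1}\to\mathfrak{g}_{-1}$ is the direct sum of the almost complex structures of the factors. With $L_pq=pq$, a continuous map $f$ is Pansu differentiable at $p$ if $\lim_{s\to0+}\delta_s^{-1}\circ L_{f(p)}^{-1}\circ f\circ L_p\circ\delta_s(q)$ exists uniformly for $q$ in compact sets; calling the limit $Df_p(q)$, the Pansu differential is $df_p=\log\circ\,Df_p\circ\exp$, a strata-preserving Lie algebra homomorphism. A diffeomorphism $f$ between domains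 is a CR mapping if, for every $p$, $df_p\in\mathrm{Aut}^\delta(\mathfrak{g})$ and $df_p|_{\mathfrak{g}_{-1}}J=J\,df_p|_{\mathfrak{g}_{-1}}$. A product CR mapping is a CR mapping $F$ of $G$ of the product form $F(p^1,\dots,p^m)=(f^1(p^1),\dots,f^m(p^m))$. A group automorphism that permutes the groups $G^j$ is $T\in\mathrm{Aut}^\delta(G)$ for which there is a permutation $\sigma$ of $\{1,\dots,m\}$ with $T(G^j)=G^{\sigma(j)}$ for all $j$. *)

theory Defs
  imports
    "HOL-Analysis.Analysis"
    "HOL-Algebra.Group"
    "HOL-Combinatorics.Permutations"
begin

section \<open>Smooth maps on open sets\<close>

text \<open>All iterated directional derivatives of order at most n exist and are continuous, S open.\<close>

primrec times_differentiable_on ::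
    "nat \<Rightarrow> 'a::real_normed_vector set \<Rightarrow> ('a \<Rightarrow> 'b::real_normed_vector) \<Rightarrow> bool" where
  "times_differentiable_on 0 S f \<longleftrightarrow> continuous_on S f"
| "times_differentiable_on (Suc n) S f \<longleftrightarrow>
     (\<forall>x\<in>S. f differentiable (at x)) \<and>
     (\<forall>v. times_differentiable_on n S (\<lambda>x. frechet_derivative f (at x) v))"

definition smooth_on :: "'a::real_normed_vector set \<Rightarrow> ('a \<Rightarrow> 'b::real_normed_vector) \<Rightarrow> bool" where
  "smooth_on S f \<longleftrightarrow> (\<forall>n. times_differentiable_on n S f)"


section \<open>Internal direct sums\<close>

definition direct_sum :: "'i set \<Rightarrow> ('i \<Rightarrow> 'g::real_vector set) \<Rightarrow> 'g set \<Rightarrow> bool" where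
  "direct_sum I V W \<longleftrightarrow>
     finite I \<and> (\<forall>i\<in>I. subspace (V i)) \<and> bij_betw (\<lambda>c. \<Sum>i\<in>I. c i) (\<Pi>\<^sub>E i\<in>I. V i) W"

definition component :: "'i set \<Rightarrow> ('i \<Rightarrow> 'g::real_vector set) \<Rightarrow> 'i \<Rightarrow> 'g \<Rightarrow> 'g" where
  "component I V i x = inv_into (\<Pi>\<^sub>E i\<in>I. V i) (\<lambda>c. \<Sum>i\<in>I. c i) x i"


section \<open>Stratified Lie algebras\<close>

text \<open>
  The bracket b lives on a whole vector space; a Lie algebra is a subset h of it.
  The set L j is the layer usually written with index -j; only the indices from 1
  up to one more than the step matter.
\<close>

definition lie_bracket :: "('g::euclidean_space \<Rightarrow> 'g \<Rightarrow> 'g) \<Rightarrow> bool" where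
  "lie_bracket b \<longleftrightarrow>
     bilinear b \<and> (\<forall>x. b x x = 0) \<and> (\<forall>x y z. b x (b y z) + b y (b z x) + b z (b x y) = 0)"

definition lie_subalgebra :: "('g::euclidean_space \<Rightarrow> 'g \<Rightarrow> 'g) \<Rightarrow> 'g set \<Rightarrow> bool" where
  "lie_subalgebra b h \<longleftrightarrow> subspace h \<and> (\<forall>x\<in>h. \<forall>y\<in>h. b x y \<in> h)"

definition centre :: "('g::euclidean_space \<Rightarrow> 'g \<Rightarrow> 'g) \<Rightarrow> 'g set \<Rightarrow> 'g set" where
  "centre b h = {z \<in> h. \<forall>x\<in>h. b z x = 0}"

definition stratified_algebra ::
    "('g::euclidean_space \<Rightarrow> 'g \<Rightarrow> 'g) \<Rightarrow> 'g set \<Rightarrow> (nat \<Rightarrow> 'g set) \<Rightarrow> nat \<Rightarrow> bool" where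
  "stratified_algebra b h L n \<longleftrightarrow>
     lie_subalgebra b h \<and> dim h \<ge> 3 \<and>
     direct_sum {1..n} L h \<and>
     (\<forall>j\<in>{1..n}. span {b x y | x y. x \<in> L j \<and> y \<in> L 1} = L (Suc j)) \<and>
     L n \<noteq> {0} \<and> L (Suc n) = {0}"

definition totally_nonabelian ::
    "('g::euclidean_space \<Rightarrow> 'g \<Rightarrow> 'g) \<Rightarrow> 'g set \<Rightarrow> (nat \<Rightarrow> 'g set) \<Rightarrow> bool" where
  "totally_nonabelian b h L \<longleftrightarrow> L 1 \<inter> centre b h = {0}"

text \<open>The layers of a graded subspace V are the intersections of V with the L j.\<close>

definition graded_ideal ::
    "('g::euclidean_space \<Rightarrow> 'g \<Rightarrow> 'g) \<Rightarrow> 'g set \<Rightarrow> (nat \<Rightarrow> 'g set) \<Rightarrow> nat \<Rightarrow> 'g set \<Rightarrow> bool" where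
  "graded_ideal b h L n W \<longleftrightarrow>
     W \<subseteq> h \<and> (\<forall>x\<in>h. \<forall>y\<in>W. b x y \<in> W) \<and> direct_sum {1..n} (\<lambda>j. L j \<inter> W) W"

text \<open>
  The finest decomposition is the common refinement of all decompositions into graded
  ideals. The grading is essential: for two Heisenberg algebras with bases (X, Y, U) and
  (X', Y', U'), the ideals spanned by X + U', Y, U and by X', Y', U' are complementary, but
  the first of them is not a sum of Heisenberg factors.
\<close>

definition finest_decomposition ::
    "('g::euclidean_space \<Rightarrow> 'g \<Rightarrow> 'g) \<Rightarrow> 'g set \<Rightarrow> (nat \<Rightarrow> 'g set) \<Rightarrow> nat \<Rightarrow>
     nat \<Rightarrow> (nat \<Rightarrow> 'g set) \<Rightarrow> bool" where
  "finest_decomposition b h L n m V \<longleftrightarrow>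
     direct_sum {1..m} V h \<and>
     (\<forall>k\<in>{1..m}. V k \<noteq> {0} \<and> (\<exists>nk. stratified_algebra b (V k) (\<lambda>j. L j \<inter> V k) nk) \<and>
        totally_nonabelian b (V k) (\<lambda>j. L j \<inter> V k)) \<and>
     (\<forall>k\<in>{1..m}. \<forall>l\<in>{1..m}. k \<noteq> l \<longrightarrow> (\<forall>x\<in>V k. \<forall>y\<in>V l. b x y = 0)) \<and>
     (\<forall>(q::nat) W. direct_sum {1..q} W h \<and> (\<forall>l\<in>{1..q}. graded_ideal b h L n (W l)) \<longrightarrow>
        (\<exists>I. disjoint_family_on I {1..q} \<and> (\<Union>l\<in>{1..q}. I l) = {1..m} \<and>
             (\<forall>l\<in>{1..q}. direct_sum (I l) V (W l))))"

definition tight :: "('g::euclidean_space \<Rightarrow> 'g \<Rightarrow> 'g) \<Rightarrow> 'g set \<Rightarrow> (nat \<Rightarrow> 'g set) \<Rightarrow> bool" where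
  "tight b h L \<longleftrightarrow>
     (\<exists>n. stratified_algebra b h L n \<and> totally_nonabelian b h L \<and>
          (\<exists>V. finest_decomposition b h L n 1 V) \<and> dim (L 2) = 1)"

definition tight_basis ::
    "('g::euclidean_space \<Rightarrow> 'g \<Rightarrow> 'g) \<Rightarrow> (nat \<Rightarrow> 'g set) \<Rightarrow>
     nat \<Rightarrow> (nat \<Rightarrow> 'g) \<Rightarrow> (nat \<Rightarrow> 'g) \<Rightarrow> 'g \<Rightarrow> bool" where
  "tight_basis b L r X Y U \<longleftrightarrow>
     inj_on X {1..r} \<and> inj_on Y {1..r} \<and> X ` {1..r} \<inter> Y ` {1..r} = {} \<and>
     independent (X ` {1..r} \<union> Y ` {1..r}) \<and> span (X ` {1..r} \<union> Y ` {1..r}) = L 1 \<and>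
     span {U} = L 2 \<and>
     (\<forall>j\<in>{1..r}. \<forall>l\<in>{1..r}.
        b (X j) (X l) = 0 \<and> b (Y j) (Y l) = 0 \<and> b (X j) (Y l) = (if j = l then U else 0))"

text \<open>
  J is determined on the first layer of the factor only. A linear map of the whole space that
  satisfies this for every factor restricts on the first layer to the direct sum of the almost
  complex structures; its values elsewhere are never used.
\<close>

definition almost_complex_structure ::
    "('g::euclidean_space \<Rightarrow> 'g) \<Rightarrow> nat \<Rightarrow> (nat \<Rightarrow> 'g) \<Rightarrow> (nat \<Rightarrow> 'g) \<Rightarrow> bool" where
  "almost_complex_structure J r X Y \<longleftrightarrow>
     linear J \<and> (\<forall>j\<in>{1..r}. J (X j) = Y j \<and> J (Y j) = - X j)"


section \<open>Stratified groups\<close>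

record ('p, 'g) stratified_data = "'p monoid" +
  Exp :: "'g \<Rightarrow> 'p"
  brak :: "'g \<Rightarrow> 'g \<Rightarrow> 'g"
  layer :: "nat \<Rightarrow> 'g set"
  step :: nat

definition Log :: "('p, 'g::euclidean_space, 'z) stratified_data_scheme \<Rightarrow> 'p \<Rightarrow> 'g" where
  "Log G = inv_into UNIV (Exp G)"

definition Ad :: "('p, 'g::euclidean_space, 'z) stratified_data_scheme \<Rightarrow> 'p \<Rightarrow> 'g \<Rightarrow> 'g" where
  "Ad G p y = vector_derivative (\<lambda>s. Log G (p \<otimes>\<^bsub>G\<^esub> Exp G (s *\<^sub>R y) \<otimes>\<^bsub>G\<^esub> inv\<^bsub>G\<^esub> p)) (at 0)"

text \<open>
  For a connected simply connected nilpotent Lie group, exp is a global diffeomorphism, so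
  Log is used as a global chart and carries the whole manifold structure (conversely, a group
  with such a chart is connected and simply connected). That Exp is the exponential map means
  that it maps lines through 0 to one-parameter subgroups; the tangent space at the identity is
  identified with the Lie algebra by the derivative of Log. The last clause says that brak is
  the Lie bracket of the group, as ad is the derivative of Ad. Smoothness of the inverse is
  automatic, because it is negation in this chart.
\<close>

definition exponential_lie_group :: "('p, 'g::euclidean_space, 'z) stratified_data_scheme \<Rightarrow> bool" where
  "exponential_lie_group G \<longleftrightarrow>
     group G \<and> bij_betw (Exp G) UNIV (carrier G) \<and>
     smooth_on UNIV (\<lambda>(x, y). Log G (Exp G x \<otimes>\<^bsub>G\<^esub> Exp G y)) \<and>
     (\<forall>s t x. Exp G ((s + t) *\<^sub>R x) = Exp G (s *\<^sub>R x) \<otimes>\<^bsub>G\<^esub> Exp G (t *\<^sub>R x)) \<and>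
     (\<forall>x y. ((\<lambda>t. Ad G (Exp G (t *\<^sub>R x)) y) has_vector_derivative brak G x y) (at 0))"

definition stratified_group :: "('p, 'g::euclidean_space, 'z) stratified_data_scheme \<Rightarrow> bool" where
  "stratified_group G \<longleftrightarrow>
     lie_bracket (brak G) \<and> stratified_algebra (brak G) UNIV (layer G) (step G) \<and>
     exponential_lie_group G"

text \<open>The sub-Riemannian distance. The velocity is translated back to the identity.\<close>

definition scalar_product_on :: "'g::euclidean_space set \<Rightarrow> ('g \<Rightarrow> 'g \<Rightarrow> real) \<Rightarrow> bool" where
  "scalar_product_on W ip \<longleftrightarrow>
     (\<forall>x\<in>W. \<forall>y\<in>W. \<forall>z\<in>W. ip (x + y) z = ip x z + ip y z) \<and>
     (\<forall>c. \<forall>x\<in>W. \<forall>y\<in>W. ip (c *\<^sub>R x) y = c * ip x y) \<and>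
     (\<forall>x\<in>W. \<forall>y\<in>W. ip x y = ip y x) \<and>
     (\<forall>x\<in>W. x \<noteq> 0 \<longrightarrow> ip x x > 0)"

definition velocity ::
    "('p, 'g::euclidean_space, 'z) stratified_data_scheme \<Rightarrow> (real \<Rightarrow> 'p) \<Rightarrow> real \<Rightarrow> 'g" where
  "velocity G c t = vector_derivative (\<lambda>s. Log G (inv\<^bsub>G\<^esub> (c t) \<otimes>\<^bsub>G\<^esub> c s)) (at t)"

definition horizontal_curve ::
    "('p, 'g::euclidean_space, 'z) stratified_data_scheme \<Rightarrow> (real \<Rightarrow> 'p) \<Rightarrow> bool" where
  "horizontal_curve G c \<longleftrightarrow>
     c \<in> {0..1} \<rightarrow> carrier G \<and> (Log G \<circ> c) piecewise_C1_differentiable_on {0..1} \<and>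
     (\<exists>S. finite S \<and> (\<forall>t\<in>{0<..<1} - S. velocity G c t \<in> layer G 1))"

definition sub_riemannian_distance ::
    "('p, 'g::euclidean_space, 'z) stratified_data_scheme \<Rightarrow> ('g \<Rightarrow> 'g \<Rightarrow> real) \<Rightarrow> 'p \<Rightarrow> 'p \<Rightarrow> real" where
  "sub_riemannian_distance G ip p q =
     (INF c \<in> {c. horizontal_curve G c \<and> c 0 = p \<and> c 1 = q}.
        integral {0..1} (\<lambda>t. sqrt (ip (velocity G c t) (velocity G c t))))"

definition carnot_group ::
    "('p, 'g::euclidean_space, 'z) stratified_data_scheme \<Rightarrow> ('p \<Rightarrow> 'p \<Rightarrow> real) \<Rightarrow> bool" where
  "carnot_group G d \<longleftrightarrow>
     stratified_group G \<and>
     (\<exists>ip. scalar_product_on (layer G 1) ip \<and>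
        (\<forall>p\<in>carrier G. \<forall>q\<in>carrier G. d p q = sub_riemannian_distance G ip p q))"


section \<open>Dilations and automorphisms\<close>

definition dil :: "('p, 'g::euclidean_space, 'z) stratified_data_scheme \<Rightarrow> real \<Rightarrow> 'g \<Rightarrow> 'g" where
  "dil G s x = (\<Sum>j=1..step G. s ^ j *\<^sub>R component {1..step G} (layer G) j x)"

definition group_dil :: "('p, 'g::euclidean_space, 'z) stratified_data_scheme \<Rightarrow> real \<Rightarrow> 'p \<Rightarrow> 'p" where
  "group_dil G s = Exp G \<circ> dil G s \<circ> Log G"

definition lie_aut_dil :: "('p, 'g::euclidean_space, 'z) stratified_data_scheme \<Rightarrow> ('g \<Rightarrow> 'g) set" where
  "lie_aut_dil G =
     {A. linear A \<and> bij A \<and> (\<forall>x y. A (brak G x y) = brak G (A x) (A y)) \<and>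
         (\<forall>s>0. \<forall>x. A (dil G s x) = dil G s (A x))}"

text \<open>Openness, connectedness and smoothness are read in the global chart Log.\<close>

definition group_domain :: "('p, 'g::euclidean_space, 'z) stratified_data_scheme \<Rightarrow> 'p set \<Rightarrow> bool" where
  "group_domain G D \<longleftrightarrow>
     D \<subseteq> carrier G \<and> D \<noteq> {} \<and> open (Log G ` D) \<and> connected (Log G ` D)"

definition group_diffeo ::
    "('p, 'g::euclidean_space, 'z) stratified_data_scheme \<Rightarrow> 'p set \<Rightarrow> 'p set \<Rightarrow> ('p \<Rightarrow> 'p) \<Rightarrow> bool" where
  "group_diffeo G D D' f \<longleftrightarrow>
     bij_betw f D D' \<and>
     smooth_on (Log G ` D) (Log G \<circ> f \<circ> Exp G) \<and>
     smooth_on (Log G ` D') (Log G \<circ> inv_into D f \<circ> Exp G)"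

definition group_aut_dil :: "('p, 'g::euclidean_space, 'z) stratified_data_scheme \<Rightarrow> ('p \<Rightarrow> 'p) set" where
  "group_aut_dil G =
     {T. T \<in> iso G G \<and> group_diffeo G (carrier G) (carrier G) T \<and>
         (\<forall>s>0. \<forall>p\<in>carrier G. T (group_dil G s p) = group_dil G s (T p))}"


section \<open>Pansu differentials and CR mappings\<close>

text \<open>
  The inverse of the dilation with factor s is the dilation with factor 1/s. For p in an open
  set and q in a compact set, f is evaluated only inside the open set once s is small.
\<close>

definition has_pansu_derivative ::
    "('p, 'g::euclidean_space, 'z) stratified_data_scheme \<Rightarrow> ('p \<Rightarrow> 'p) \<Rightarrow> 'p \<Rightarrow> ('p \<Rightarrow> 'p) \<Rightarrow> bool" where
  "has_pansu_derivative G f p D \<longleftrightarrow>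
     D \<in> carrier G \<rightarrow> carrier G \<and>
     (\<forall>K. compact K \<longrightarrow>
        uniform_limit K
          (\<lambda>s x. Log G (group_dil G (1 / s) (inv\<^bsub>G\<^esub> (f p) \<otimes>\<^bsub>G\<^esub> f (p \<otimes>\<^bsub>G\<^esub> group_dil G s (Exp G x)))))
          (\<lambda>x. Log G (D (Exp G x))) (at_right 0))"

definition cr_mapping ::
    "('p, 'g::euclidean_space, 'z) stratified_data_scheme \<Rightarrow> ('g \<Rightarrow> 'g) \<Rightarrow> 'p set \<Rightarrow> 'p set \<Rightarrow>
     ('p \<Rightarrow> 'p) \<Rightarrow> bool" where
  "cr_mapping G J D D' f \<longleftrightarrow>
     group_domain G D \<and> group_domain G D' \<and> group_diffeo G D D' f \<and>
     (\<forall>p\<in>D. \<exists>Df. has_pansu_derivative G f p Df \<and>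
        (let df = Log G \<circ> Df \<circ> Exp G
         in df \<in> lie_aut_dil G \<and> (\<forall>x\<in>layer G 1. df (J x) = J (df x))))"


section \<open>Product decompositions of the group\<close>

text \<open>
  V is a decomposition of the Lie algebra; the factors of the group are the images of the V k
  under Exp, and a tuple of elements of the factors is identified with its product in G.
\<close>

definition factor :: "('p, 'g::euclidean_space, 'z) stratified_data_scheme \<Rightarrow> (nat \<Rightarrow> 'g set) \<Rightarrow> nat \<Rightarrow> 'p set" where
  "factor G V k = Exp G ` V k"

primrec ordered_prod :: "('p, 'z) monoid_scheme \<Rightarrow> (nat \<Rightarrow> 'p) \<Rightarrow> nat \<Rightarrow> 'p" where
  "ordered_prod G P 0 = \<one>\<^bsub>G\<^esub>"
| "ordered_prod G P (Suc n) = ordered_prod G P n \<otimes>\<^bsub>G\<^esub> P (Suc n)"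

definition permutes_factors ::
    "('p, 'g::euclidean_space, 'z) stratified_data_scheme \<Rightarrow> nat \<Rightarrow> (nat \<Rightarrow> 'g set) \<Rightarrow> ('p \<Rightarrow> 'p) \<Rightarrow> bool" where
  "permutes_factors G m V T \<longleftrightarrow>
     T \<in> group_aut_dil G \<and>
     (\<exists>\<sigma>. \<sigma> permutes {1..m} \<and> (\<forall>j\<in>{1..m}. T ` factor G V j = factor G V (\<sigma> j)))"

definition product_form ::
    "('p, 'g::euclidean_space, 'z) stratified_data_scheme \<Rightarrow> nat \<Rightarrow> (nat \<Rightarrow> 'g set) \<Rightarrow>
     (nat \<Rightarrow> 'p \<Rightarrow> 'p) \<Rightarrow> ('p \<Rightarrow> 'p) \<Rightarrow> bool" where
  "product_form G m V fs F \<longleftrightarrow>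
     (\<forall>j\<in>{1..m}. fs j \<in> factor G V j \<rightarrow> factor G V j) \<and>
     (\<forall>P. (\<forall>j\<in>{1..m}. P j \<in> factor G V j) \<longrightarrow>
        F (ordered_prod G P m) = ordered_prod G (\<lambda>j. fs j (P j)) m)"

end

theory Submission
  imports Defs
begin

text \<open>
  Each Pansu differential of f is a graded automorphism, so by uniqueness of the finest
  decomposition it permutes the summands; on the first layer it agrees with the ordinary
  differential, hence depends continuously on the point, and the permutation is constant. Let T
  be the automorphism integrating the Pansu differential at the identity. Then F, the inverse of
  T composed with f, is CR with differentials preserving every summand. So the component of F in
  one factor does not change along the first layers of the other factors; the left-invariant
  directions along which it does not change form a Lie algebra, so it does not change along the
  other factors at all.

  That Lie algebra homomorphisms are group homomorphisms in exponential coordinates replaces the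
  Campbell-Hausdorff formula: along a ray, the Maurer-Cartan form w of the group solves the
  linear equation w' = v - [z, w], so it is determined by the bracket.
\<close>

section \<open>Smooth maps and direct sums\<close>

text \<open>The Pansu differentials are given point by point, with no regularity in the point.
  Continuity can be recovered only on the first layer, and this suffices because the first layer
  generates: every factor contains a nonzero vector of it, which detects where the factor is sent,
  and a Lie algebra of directions that contains the first layer of a factor contains the factor. The
  passage from Lie algebra to group homomorphisms is needed three times: to integrate the
  differential at the identity, to pull the inverse of that automorphism through the difference
  quotients of f, and to make the projections onto the factors group homomorphisms, so that
  components of products can be computed. The closure of the invariant directions under the bracket
  is obtained from conjugation in the group rather than from commutators of vector fields, so first
  derivatives are enough.\<close>

lemma times_differentiable_on_const: "times_differentiable_on n UNIV (\<lambda>x. c)"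
  by (induction n arbitrary: c) (auto simp: frechet_derivative_const)

lemma times_differentiable_on_bounded_linear:
  assumes "bounded_linear A"
  shows "times_differentiable_on n UNIV A"
proof (cases n)
  case 0
  then show ?thesis
    using assms by (simp add: linear_continuous_on)
next
  case (Suc k)
  have "frechet_derivative A (at x) = A" for x
    by (metis assms bounded_linear_imp_has_derivative frechet_derivative_at)
  then show ?thesis
    using assms Suc by (auto simp: times_differentiable_on_const bounded_linear_imp_differentiable)
qed

lemma times_differentiable_on_linear_compose:
  assumes "bounded_linear B" "times_differentiable_on n UNIV f"
  shows "times_differentiable_on n UNIV (\<lambda>x. B (f x))"
  using assms(2)
proof (induction n arbitrary: f)
  case 0
  then show ?case
    using assms(1) bounded_linear.continuous_on by auto
next
  case (Suc n)
  have *: "((\<lambda>x. B (f x)) has_derivative (\<lambda>v. B (frechet_derivative f (at x) v))) (at x)" for x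
    using Suc.prems assms(1) bounded_linear.has_derivative frechet_derivative_works by fastforce
  have "frechet_derivative (\<lambda>x. B (f x)) (at x) = (\<lambda>v. B (frechet_derivative f (at x) v))" for x
    using * frechet_derivative_at by metis
  with * Suc show ?case
    by (auto simp: differentiable_def)
qed

text \<open>The derivative of \<open>f \<circ> A\<close> along \<open>v\<close> is the derivative of
  \<open>f\<close> along the fixed vector \<open>A v\<close>, again composed with \<open>A\<close>.
  The induction therefore closes without a chain rule of higher order.\<close>

lemma times_differentiable_on_compose_linear:
  assumes "bounded_linear A" "times_differentiable_on n UNIV f"
  shows "times_differentiable_on n UNIV (\<lambda>x. f (A x))"
  using assms(2)
proof (induction n arbitrary: f)
  case 0
  then show ?case
    using assms(1) continuous_on_compose2 linear_continuous_on by fastforce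
next
  case (Suc n)
  have *: "((\<lambda>x. f (A x)) has_derivative (\<lambda>v. frechet_derivative f (at (A x)) (A v))) (at x)" for x
  proof -
    have "(f has_derivative frechet_derivative f (at (A x))) (at (A x))"
      using Suc.prems frechet_derivative_works by fastforce
    from has_derivative_compose[OF bounded_linear_imp_has_derivative[OF assms(1)] this]
    show ?thesis .
  qed
  have "frechet_derivative (\<lambda>x. f (A x)) (at x) = (\<lambda>v. frechet_derivative f (at (A x)) (A v))" for x
    using * frechet_derivative_at by metis
  with * Suc.IH[of "\<lambda>x. frechet_derivative f (at x) v" for v] Suc.prems show ?case
    by (auto simp: differentiable_def)
qed

lemma smooth_on_differentiable:
  assumes "smooth_on UNIV f"
  shows "f differentiable (at x)"
proof -
  have "times_differentiable_on (Suc 0) UNIV f"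
    using assms by (simp only: smooth_on_def)
  then show ?thesis
    by simp
qed

lemma smooth_on_continuous_derivative:
  assumes "smooth_on UNIV f"
  shows "continuous_on UNIV (\<lambda>x. frechet_derivative f (at x) v)"
proof -
  have "times_differentiable_on (Suc 0) UNIV f"
    using assms by (simp only: smooth_on_def)
  then show ?thesis
    by simp
qed

text \<open>Smoothness gives continuity in the base point for each fixed direction only. In finite
  dimension a varying direction can be expanded in the basis, which gives continuity in both at
  once.\<close>

lemma continuous_on_frechet_derivative_apply:
  fixes f :: "'a::euclidean_space \<Rightarrow> 'b::real_normed_vector"
  assumes "smooth_on UNIV f" "continuous_on S g" "continuous_on S w"
  shows "continuous_on S (\<lambda>z. frechet_derivative f (at (g z)) (w z))"
proof -
  have lin: "linear (frechet_derivative f (at x))" for x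
    using assms(1) linear_frechet_derivative smooth_on_differentiable by blast
  have basis: "frechet_derivative f (at x) v =
      (\<Sum>i\<in>Basis. (v \<bullet> i) *\<^sub>R frechet_derivative f (at x) i)" for x v
  proof -
    have "frechet_derivative f (at x) v = frechet_derivative f (at x) (\<Sum>i\<in>Basis. (v \<bullet> i) *\<^sub>R i)"
      by (simp add: euclidean_representation)
    then show ?thesis
      using lin[of x] by (simp add: linear_sum linear_scale)
  qed
  then have eq: "(\<lambda>z. frechet_derivative f (at (g z)) (w z)) =
      (\<lambda>z. \<Sum>i\<in>Basis. (w z \<bullet> i) *\<^sub>R frechet_derivative f (at (g z)) i)"
    by (intro ext basis)
  have "continuous_on S (\<lambda>z. frechet_derivative f (at (g z)) i)" for i
    using continuous_on_compose2[OF smooth_on_continuous_derivative[OF assms(1)] assms(2)] by simp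
  then show ?thesis
    unfolding eq using assms(3) by (intro continuous_intros)
qed

section \<open>Components with respect to an internal direct sum\<close>

lemma component_sum:
  assumes "direct_sum I V W" "\<And>i. i \<in> I \<Longrightarrow> c i \<in> V i" "k \<in> I"
  shows "component I V k (\<Sum>i\<in>I. c i) = c k"
proof -
  have inj: "inj_on (\<lambda>c. \<Sum>i\<in>I. c i) (\<Pi>\<^sub>E i\<in>I. V i)"
    using assms(1) by (auto simp: direct_sum_def bij_betw_def)
  have r: "restrict c I \<in> (\<Pi>\<^sub>E i\<in>I. V i)"
    using assms(2) by auto
  have "(\<Sum>i\<in>I. c i) = (\<Sum>i\<in>I. restrict c I i)"
    by (rule sum.cong) auto
  then show ?thesis
    unfolding component_def using inv_into_f_f[OF inj r] assms(3) by auto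
qed

lemma direct_sum_decompose:
  assumes "direct_sum I V W" "x \<in> W"
  obtains c where "\<And>i. i \<in> I \<Longrightarrow> c i \<in> V i" "x = (\<Sum>i\<in>I. c i)"
proof -
  have "x \<in> (\<lambda>c. \<Sum>i\<in>I. c i) ` (\<Pi>\<^sub>E i\<in>I. V i)"
    using assms by (simp add: direct_sum_def bij_betw_def)
  then show ?thesis
    using that by fastforce
qed

lemma component_in:
  assumes "direct_sum I V W" "x \<in> W" "k \<in> I"
  shows "component I V k x \<in> V k"
  using assms by (metis component_sum direct_sum_decompose)

lemma sum_component:
  assumes "direct_sum I V W" "x \<in> W"
  shows "(\<Sum>i\<in>I. component I V i x) = x"
proof -
  obtain c where c: "\<And>i. i \<in> I \<Longrightarrow> c i \<in> V i" "x = (\<Sum>i\<in>I. c i)"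
    using direct_sum_decompose[OF assms] by blast
  then have "(\<Sum>i\<in>I. component I V i x) = (\<Sum>i\<in>I. c i)"
    using component_sum[OF assms(1)] by (intro sum.cong) auto
  with c show ?thesis by simp
qed

lemma component_of_summand:
  assumes "direct_sum I V W" "x \<in> V j" "j \<in> I" "k \<in> I"
  shows "component I V k x = (if k = j then x else 0)"
proof -
  let ?c = "\<lambda>i. if i = j then x else 0"
  have "(\<Sum>i\<in>I. ?c i) = x"
    using assms(1,3) by (simp add: direct_sum_def)
  moreover have "?c i \<in> V i" if "i \<in> I" for i
    using assms that by (auto simp: direct_sum_def subspace_0)
  ultimately show ?thesis
    using component_sum[OF assms(1), of ?c k] assms(4) by simp
qed

lemma linear_component:
  assumes "direct_sum I V UNIV" "k \<in> I"
  shows "linear (component I V k)"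
proof -
  have sub: "subspace (V i)" if "i \<in> I" for i
    using assms that by (auto simp: direct_sum_def)
  note in' = component_in[OF assms(1) UNIV_I] and su = sum_component[OF assms(1) UNIV_I]
  show ?thesis
  proof (rule linearI)
    fix x y
    have "component I V k (\<Sum>i\<in>I. component I V i x + component I V i y)
        = component I V k x + component I V k y"
      using in' sub assms by (intro component_sum) (auto simp: subspace_add)
    then show "component I V k (x + y) = component I V k x + component I V k y"
      by (simp add: sum.distrib su)
  next
    fix a x
    have "component I V k (\<Sum>i\<in>I. a *\<^sub>R component I V i x) = a *\<^sub>R component I V k x"
      using in' sub assms by (intro component_sum) (auto simp: subspace_scale)
    then show "component I V k (a *\<^sub>R x) = a *\<^sub>R component I V k x"
      by (simp flip: scaleR_right.sum add: su)
  qed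
qed

lemma direct_sum_linear_image:
  assumes "direct_sum I V UNIV" "linear A" "linear B" and BA: "\<And>x. B (A x) = x" and AB: "\<And>x. A (B x) = x"
  shows "direct_sum I (\<lambda>i. A ` V i) UNIV"
  unfolding direct_sum_def
proof (intro conjI ballI)
  show "finite I"
    using assms by (auto simp: direct_sum_def)
  show "subspace (A ` V i)" if "i \<in> I" for i
    using assms that by (auto simp: direct_sum_def intro: linear_subspace_image)
  show "bij_betw (\<lambda>c. \<Sum>i\<in>I. c i) (\<Pi>\<^sub>E i\<in>I. A ` V i) UNIV"
    unfolding bij_betw_def
  proof
    have comp: "component I V i (B (\<Sum>i\<in>I. c i)) = B (c i)"
      if "c \<in> (\<Pi>\<^sub>E i\<in>I. A ` V i)" "i \<in> I" for c i
    proof -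
      have "B (\<Sum>i\<in>I. c i) = (\<Sum>i\<in>I. B (c i))"
        using assms(3) by (simp add: linear_sum)
      moreover have "B (c i) \<in> V i" if "i \<in> I" for i
        using that \<open>c \<in> (\<Pi>\<^sub>E i\<in>I. A ` V i)\<close> BA by (force simp: PiE_iff)
      ultimately show ?thesis
        using component_sum[OF assms(1), of "\<lambda>i. B (c i)" i] that by simp
    qed
    show "inj_on (\<lambda>c. \<Sum>i\<in>I. c i) (\<Pi>\<^sub>E i\<in>I. A ` V i)"
    proof (rule inj_onI)
      fix c d assume c: "c \<in> (\<Pi>\<^sub>E i\<in>I. A ` V i)" and d: "d \<in> (\<Pi>\<^sub>E i\<in>I. A ` V i)"
        and eq: "(\<Sum>i\<in>I. c i) = (\<Sum>i\<in>I. d i)"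
      have "B (c i) = B (d i)" if "i \<in> I" for i
        using comp[OF c that] comp[OF d that] eq by simp
      then have "c i = d i" if "i \<in> I" for i
        using that AB by metis
      then show "c = d"
        using c d by (meson PiE_ext)
    qed
    show "(\<lambda>c. \<Sum>i\<in>I. c i) ` (\<Pi>\<^sub>E i\<in>I. A ` V i) = UNIV"
    proof -
      have "x \<in> (\<lambda>c. \<Sum>i\<in>I. c i) ` (\<Pi>\<^sub>E i\<in>I. A ` V i)" for x
      proof
        let ?c = "restrict (\<lambda>i. A (component I V i (B x))) I"
        show "?c \<in> (\<Pi>\<^sub>E i\<in>I. A ` V i)"
          using component_in[OF assms(1)] by auto
        have "x = A (\<Sum>i\<in>I. component I V i (B x))"
          using sum_component[OF assms(1)] AB by simp
        then show "x = (\<Sum>i\<in>I. ?c i)"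
          using assms(2) by (simp add: linear_sum)
      qed
      then show ?thesis by auto
    qed
  qed
qed

text \<open>A subspace stable under the projections to the layers is graded; this is how images of
  factors are recognised as graded ideals.\<close>

lemma direct_sum_Int:
  assumes "direct_sum I L UNIV" "subspace W"
    and "\<And>x i. x \<in> W \<Longrightarrow> i \<in> I \<Longrightarrow> component I L i x \<in> W"
  shows "direct_sum I (\<lambda>i. L i \<inter> W) W"
  unfolding direct_sum_def
proof (intro conjI ballI)
  show "finite I"
    using assms by (auto simp: direct_sum_def)
  show "subspace (L i \<inter> W)" if "i \<in> I" for i
    using assms that by (auto simp: direct_sum_def subspace_inter)
  show "bij_betw (\<lambda>c. \<Sum>i\<in>I. c i) (\<Pi>\<^sub>E i\<in>I. L i \<inter> W) W"
    unfolding bij_betw_def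
  proof
    have "inj_on (\<lambda>c. \<Sum>i\<in>I. c i) (\<Pi>\<^sub>E i\<in>I. L i)"
      using assms by (auto simp: direct_sum_def bij_betw_def)
    then show "inj_on (\<lambda>c. \<Sum>i\<in>I. c i) (\<Pi>\<^sub>E i\<in>I. L i \<inter> W)"
      by (rule inj_on_subset) (auto simp: PiE_iff)
    show "(\<lambda>c. \<Sum>i\<in>I. c i) ` (\<Pi>\<^sub>E i\<in>I. L i \<inter> W) = W"
    proof
      show "(\<lambda>c. \<Sum>i\<in>I. c i) ` (\<Pi>\<^sub>E i\<in>I. L i \<inter> W) \<subseteq> W"
        using assms(2) by (auto simp: PiE_iff intro!: subspace_sum)
      show "W \<subseteq> (\<lambda>c. \<Sum>i\<in>I. c i) ` (\<Pi>\<^sub>E i\<in>I. L i \<inter> W)"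
      proof
        fix x assume "x \<in> W"
        let ?c = "restrict (\<lambda>i. component I L i x) I"
        have "x = (\<Sum>i\<in>I. ?c i)"
          using sum_component[OF assms(1), of x] by simp
        moreover have "?c \<in> (\<Pi>\<^sub>E i\<in>I. L i \<inter> W)"
          using assms(3)[OF \<open>x \<in> W\<close>] component_in[OF assms(1)] by auto
        ultimately show "x \<in> (\<lambda>c. \<Sum>i\<in>I. c i) ` (\<Pi>\<^sub>E i\<in>I. L i \<inter> W)"
          by blast
      qed
    qed
  qed
qed

text \<open>In the form of a limit of quotients, a derivative can be located in a closed subspace or
  compared with a one-sided limit.\<close>

lemma has_vector_derivative_at_lim:
  "(f has_vector_derivative f') (at x) \<longleftrightarrow> ((\<lambda>y. (f y - f x) /\<^sub>R (y - x)) \<longlongrightarrow> f') (at x)"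
proof -
  have "norm ((1 / norm (y - x)) *\<^sub>R (f y - (f x + (y - x) *\<^sub>R f'))) =
      norm ((f y - f x) /\<^sub>R (y - x) - f')" if "y \<noteq> x" for y
  proof -
    have "(f y - f x) /\<^sub>R (y - x) - f' = (f y - (f x + (y - x) *\<^sub>R f')) /\<^sub>R (y - x)"
      using that by (simp add: scaleR_diff_right scaleR_add_right)
    then show ?thesis
      by (simp add: divide_inverse)
  qed
  then have "((\<lambda>y. norm ((1 / norm (y - x)) *\<^sub>R (f y - (f x + (y - x) *\<^sub>R f')))) \<longlongrightarrow> 0) (at x) \<longleftrightarrow>
      ((\<lambda>y. norm ((f y - f x) /\<^sub>R (y - x) - f')) \<longlongrightarrow> 0) (at x)"
    by (intro filterlim_cong) (auto simp: eventually_at_filter)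
  then show ?thesis
    unfolding has_vector_derivative_def has_derivative_within tendsto_norm_zero_iff LIM_zero_iff
    by (simp add: bounded_linear_scaleR_left)
qed

section \<open>Group laws in exponential coordinates\<close>

text \<open>Gronwall's argument: if \<open>K\<close> bounds \<open>B\<close>, the derivative of the
  squared norm of \<open>e\<close> is at most \<open>2 * K\<close> times itself, so the product with
  \<open>exp (- 2 * K * t)\<close> cannot increase from its initial value 0.\<close>

lemma linear_ode_zero:
  fixes e :: "real \<Rightarrow> 'g::euclidean_space"
  assumes "bounded_linear B" "\<And>t. (e has_vector_derivative B (e t)) (at t)" "e 0 = 0" "0 \<le> t"
  shows "e t = 0"
proof -
  obtain K where K: "\<And>x. norm (B x) \<le> norm x * K"
    using bounded_linear.bounded[OF assms(1)] by blast
  let ?g = "\<lambda>t. (e t \<bullet> e t) * exp (- 2 * K * t)"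
  have "?g t \<le> ?g 0"
  proof (rule DERIV_nonpos_imp_nonincreasing[OF assms(4)])
    fix x :: real
    have e: "(e has_derivative (\<lambda>h. h *\<^sub>R B (e x))) (at x)"
      using assms(2)[of x] by (simp add: has_vector_derivative_def)
    have "((\<lambda>t. e t \<bullet> e t) has_real_derivative 2 * (e x \<bullet> B (e x))) (at x)"
      unfolding has_field_derivative_def
      by (rule has_derivative_eq_rhs[OF has_derivative_inner[OF e e]])
         (auto simp: fun_eq_iff inner_commute algebra_simps)
    then have "(?g has_real_derivative
        (2 * (e x \<bullet> B (e x)) * exp (- 2 * K * x)
          + (exp (- 2 * K * x) * (- 2 * K)) * (e x \<bullet> e x))) (at x)"
      by (rule DERIV_mult) (auto intro!: derivative_eq_intros)
    moreover have "e x \<bullet> B (e x) \<le> K * (e x \<bullet> e x)"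
    proof -
      have "e x \<bullet> B (e x) \<le> norm (e x) * norm (B (e x))"
        by (rule norm_cauchy_schwarz)
      also have "\<dots> \<le> norm (e x) * (norm (e x) * K)"
        by (simp add: K mult_left_mono)
      finally show ?thesis
        by (simp add: dot_square_norm power2_eq_square algebra_simps)
    qed
    then have "2 * (e x \<bullet> B (e x)) * exp (- 2 * K * x)
          + (exp (- 2 * K * x) * (- 2 * K)) * (e x \<bullet> e x) \<le> 0"
      by (simp add: algebra_simps)
    ultimately show "\<exists>y. DERIV ?g x :> y \<and> y \<le> 0"
      by blast
  qed
  then have "(e t \<bullet> e t) * exp (- 2 * K * t) \<le> 0"
    using assms(3) by simp
  then have "e t \<bullet> e t \<le> 0"
    by (simp add: mult_le_0_iff)
  then show ?thesis
    by (metis inner_eq_zero_iff inner_ge_zero order_antisym)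
qed

lemma has_vector_derivative_shift:
  "((\<lambda>h. u (t + h)) has_vector_derivative u') (at 0) \<longleftrightarrow> (u has_vector_derivative u') (at t)"
proof
  assume "((\<lambda>h. u (t + h)) has_vector_derivative u') (at 0)"
  then have "((\<lambda>h. u (t + h)) \<circ> (\<lambda>s. s - t) has_vector_derivative 1 *\<^sub>R u') (at t)"
    by (intro vector_diff_chain_at) (auto intro!: derivative_eq_intros)
  then show "(u has_vector_derivative u') (at t)"
    by (simp add: o_def)
next
  assume "(u has_vector_derivative u') (at t)"
  then have "(u \<circ> (\<lambda>h. t + h) has_vector_derivative 1 *\<^sub>R u') (at 0)"
    by (intro vector_diff_chain_at) (auto intro!: derivative_eq_intros)
  then show "((\<lambda>h. u (t + h)) has_vector_derivative u') (at 0)"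
    by (simp add: o_def)
qed

text \<open>The group is transported to its Lie algebra by the exponential chart, so that all
  calculus takes place in one vector space. By \<open>line\<close> the inverse is negation;
  \<open>bracket_Ad\<close> says that ad is the derivative of Ad.\<close>

locale exponential_law =
  fixes mul :: "'g::euclidean_space \<Rightarrow> 'g \<Rightarrow> 'g" (infixl "\<odot>" 70)
    and brac :: "'g \<Rightarrow> 'g \<Rightarrow> 'g"
  assumes assoc: "(x \<odot> y) \<odot> z = x \<odot> (y \<odot> z)"
    and zero_left [simp]: "0 \<odot> x = x"
    and zero_right [simp]: "x \<odot> 0 = x"
    and line: "(s *\<^sub>R x) \<odot> (t *\<^sub>R x) = (s + t) *\<^sub>R x"
    and smooth: "smooth_on UNIV (\<lambda>(x, y). x \<odot> y)"
    and bilinear: "bilinear brac"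
    and bracket_Ad: "((\<lambda>t. vector_derivative (\<lambda>s. ((t *\<^sub>R x) \<odot> (s *\<^sub>R y)) \<odot> (- (t *\<^sub>R x))) (at 0))
      has_vector_derivative brac x y) (at 0)"
begin

lemma minus_left [simp]: "(- x) \<odot> x = 0" and minus_right [simp]: "x \<odot> (- x) = 0"
  using line[of "-1" x 1] line[of 1 x "-1"] by auto

lemma cancel_left [simp]: "(- x) \<odot> (x \<odot> y) = y" "x \<odot> ((- x) \<odot> y) = y"
  by (simp_all flip: assoc)

definition dmul :: "'g \<Rightarrow> 'g \<Rightarrow> 'g \<Rightarrow> 'g \<Rightarrow> 'g" where
  "dmul p q v w = frechet_derivative (\<lambda>(x, y). x \<odot> y) (at (p, q)) (v, w)"

text \<open>The differentials at 0 of left translation by z and, respectively, of conjugation by z;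
  left_form is the left Maurer-Cartan form, the inverse of the former.\<close>

definition left_trans :: "'g \<Rightarrow> 'g \<Rightarrow> 'g" where
  "left_trans z w = dmul z 0 0 w"

definition left_form :: "'g \<Rightarrow> 'g \<Rightarrow> 'g" where
  "left_form z v = dmul (- z) z 0 v"

definition conj_diff :: "'g \<Rightarrow> 'g \<Rightarrow> 'g" where
  "conj_diff z w = dmul z (- z) (left_trans z w) 0"

section \<open>Partial differentials of the group law\<close>

lemma mul_has_derivative:
  "((\<lambda>(x, y). x \<odot> y) has_derivative (\<lambda>(v, w). dmul p q v w)) (at (p, q))"
  using smooth_on_differentiable[OF smooth, of "(p, q)"]
  by (simp add: frechet_derivative_works dmul_def)

lemma linear_dmul: "linear (\<lambda>(v, w). dmul p q v w)"
  using mul_has_derivative[of p q] has_derivative_bounded_linear bounded_linear.linear by blast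

lemma dmul_add: "dmul p q (v + v') (w + w') = dmul p q v w + dmul p q v' w'"
  using linear_add[OF linear_dmul[of p q], of "(v, w)" "(v', w')"] by simp

lemma dmul_scale: "dmul p q (a *\<^sub>R v) (a *\<^sub>R w) = a *\<^sub>R dmul p q v w"
  using linear_scale[OF linear_dmul[of p q], of a "(v, w)"] by simp

lemma dmul_0 [simp]: "dmul p q 0 0 = 0"
  using dmul_scale[of p q 0] by simp

lemma mul_has_vector_derivative:
  assumes "(u has_vector_derivative u') (at t)" "(v has_vector_derivative v') (at t)"
  shows "((\<lambda>s. u s \<odot> v s) has_vector_derivative dmul (u t) (v t) u' v') (at t)"
proof -
  have "((\<lambda>s. (u s, v s)) has_vector_derivative (u', v')) (at t)"
    using assms by (rule has_vector_derivative_Pair)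
  then have "((\<lambda>s. (\<lambda>(x, y). x \<odot> y) (u s, v s)) has_derivative
      (\<lambda>h. (\<lambda>(a, w). dmul (u t) (v t) a w) (h *\<^sub>R (u', v')))) (at t)"
    unfolding has_vector_derivative_def
    by (rule has_derivative_compose) (rule mul_has_derivative)
  then show ?thesis
    by (simp add: has_vector_derivative_def dmul_scale)
qed

lemma has_vector_derivative_line: "((\<lambda>s. p + s *\<^sub>R v) has_vector_derivative v) (at t)"
  by (auto intro!: derivative_eq_intros)

lemma dmul_right_0 [simp]: "dmul p 0 v 0 = v"
proof -
  have "((\<lambda>s. (p + s *\<^sub>R v) \<odot> 0) has_vector_derivative dmul (p + 0 *\<^sub>R v) 0 v 0) (at 0)"
    by (intro mul_has_vector_derivative has_vector_derivative_line has_vector_derivative_const)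
  then show ?thesis
    using vector_derivative_unique_at[OF _ has_vector_derivative_line] by simp
qed

lemma dmul_left_0 [simp]: "dmul 0 p 0 v = v"
proof -
  have "((\<lambda>s. 0 \<odot> (p + s *\<^sub>R v)) has_vector_derivative dmul 0 (p + 0 *\<^sub>R v) 0 v) (at 0)"
    by (intro mul_has_vector_derivative has_vector_derivative_line has_vector_derivative_const)
  then show ?thesis
    using vector_derivative_unique_at[OF _ has_vector_derivative_line] by simp
qed

lemma dmul_split: "dmul p q v w = dmul p q v 0 + dmul p q 0 w"
  using dmul_add[of p q v 0 0 w] by simp

lemma left_trans_linear: "linear (left_trans z)"
  unfolding left_trans_def using dmul_add[of z 0 0 0] dmul_scale[of z 0 _ 0]
  by (auto intro!: linearI)

lemma left_trans_has_vector_derivative: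
  assumes "(v has_vector_derivative v') (at t)" "v t = 0"
  shows "((\<lambda>s. z \<odot> v s) has_vector_derivative left_trans z v') (at t)"
  using mul_has_vector_derivative[OF has_vector_derivative_const assms(1), of z] assms(2)
  by (simp add: left_trans_def)

lemma conj_has_vector_derivative:
  assumes "(v has_vector_derivative v') (at t)" "v t = 0"
  shows "((\<lambda>s. (z \<odot> v s) \<odot> (- z)) has_vector_derivative conj_diff z v') (at t)"
  using mul_has_vector_derivative[OF left_trans_has_vector_derivative[OF assms, of z]
      has_vector_derivative_const, of "- z"] assms(2)
  by (simp add: conj_diff_def)

lemma bracket_conj_diff:
  "((\<lambda>t. conj_diff (t *\<^sub>R x) y) has_vector_derivative brac x y) (at 0)"
proof -
  have "((\<lambda>s. s *\<^sub>R y) has_vector_derivative y) (at 0)"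
    using has_vector_derivative_line[of 0 y 0] by simp
  from conj_has_vector_derivative[OF this]
  have "vector_derivative (\<lambda>s. (z \<odot> (s *\<^sub>R y)) \<odot> (- z)) (at 0) = conj_diff z y" for z
    using vector_derivative_at by fastforce
  then show ?thesis
    using bracket_Ad[of x y] by simp
qed

text \<open>The curve \<open>(- z) \<odot> (z + s v)\<close> leaves 0 with velocity
  \<open>left_form z v\<close>, and left translation by \<open>z\<close> turns it back into a
  straight line.\<close>

lemma left_trans_left_form: "left_trans z (left_form z v) = v"
proof -
  have "((\<lambda>s. (- z) \<odot> (z + s *\<^sub>R v)) has_vector_derivative left_form z v) (at 0)"
    using mul_has_vector_derivative[OF has_vector_derivative_const[of "- z"]
        has_vector_derivative_line[of z v 0]]
    by (simp add: left_form_def)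
  from left_trans_has_vector_derivative[OF this, of z]
  have "((\<lambda>s. z + s *\<^sub>R v) has_vector_derivative left_trans z (left_form z v)) (at 0)"
    by simp
  then show ?thesis
    using vector_derivative_unique_at[OF _ has_vector_derivative_line] by blast
qed

lemma left_form_left_trans: "left_form z (left_trans z w) = w"
proof -
  have "((\<lambda>s. z \<odot> (0 + s *\<^sub>R w)) has_vector_derivative left_trans z w) (at 0)"
    by (intro left_trans_has_vector_derivative has_vector_derivative_line) simp
  from mul_has_vector_derivative[OF has_vector_derivative_const this, of "- z"]
  have "((\<lambda>s. 0 + s *\<^sub>R w) has_vector_derivative left_form z (left_trans z w)) (at 0)"
    by (simp add: left_form_def)
  then show ?thesis
    using vector_derivative_unique_at[OF _ has_vector_derivative_line] by blast
qed

lemma left_form_scale: "t *\<^sub>R left_form z v = left_form z (t *\<^sub>R v)"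
  using dmul_scale[of "- z" z t 0 v] by (simp add: left_form_def)

text \<open>Let \<open>c t s\<close> be the product of \<open>- (t z)\<close> and
  \<open>t (z + s v)\<close>. Both rays are one-parameter subgroups, so \<open>c (t + h) s\<close>
  is the conjugate of \<open>c t s\<close> by \<open>- (h z)\<close>, times \<open>c h s\<close>.
  Differentiating at \<open>s = 0\<close> turns the outer product into a sum.\<close>

lemma left_form_cocycle:
  "left_form ((t + h) *\<^sub>R z) ((t + h) *\<^sub>R v) =
    conj_diff (- (h *\<^sub>R z)) (left_form (t *\<^sub>R z) (t *\<^sub>R v)) + left_form (h *\<^sub>R z) (h *\<^sub>R v)"
proof -
  define c where "c t s = (- (t *\<^sub>R z)) \<odot> (t *\<^sub>R (z + s *\<^sub>R v))" for t s
  have c': "(c t has_vector_derivative left_form (t *\<^sub>R z) (t *\<^sub>R v)) (at 0)" for t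
  proof -
    have "((\<lambda>s. t *\<^sub>R z + s *\<^sub>R (t *\<^sub>R v)) has_vector_derivative t *\<^sub>R v) (at 0)"
      by (rule has_vector_derivative_line)
    then have "((\<lambda>s. t *\<^sub>R (z + s *\<^sub>R v)) has_vector_derivative t *\<^sub>R v) (at 0)"
      by (simp add: algebra_simps)
    from mul_has_vector_derivative[OF has_vector_derivative_const this, of "- (t *\<^sub>R z)"]
    show ?thesis
      by (simp add: left_form_def c_def[abs_def])
  qed
  have c0: "c t 0 = 0" for t
    by (simp add: c_def)
  have "c (t + h) s = (((- (h *\<^sub>R z)) \<odot> c t s) \<odot> (- (- (h *\<^sub>R z)))) \<odot> c h s" for s
  proof -
    have 1: "- ((t + h) *\<^sub>R z) = (- (h *\<^sub>R z)) \<odot> (- (t *\<^sub>R z))"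
      using line[of "-h" z "-t"] by (simp add: algebra_simps)
    have 2: "(t + h) *\<^sub>R (z + s *\<^sub>R v) = (t *\<^sub>R (z + s *\<^sub>R v)) \<odot> (h *\<^sub>R (z + s *\<^sub>R v))"
      by (rule line[symmetric])
    show ?thesis
      unfolding c_def 1 2 by (simp add: assoc)
  qed
  then have eq: "c (t + h) = (\<lambda>s. (((- (h *\<^sub>R z)) \<odot> c t s) \<odot> (- (- (h *\<^sub>R z)))) \<odot> c h s)"
    by auto
  have "(c (t + h) has_vector_derivative
      dmul 0 0 (conj_diff (- (h *\<^sub>R z)) (left_form (t *\<^sub>R z) (t *\<^sub>R v)))
        (left_form (h *\<^sub>R z) (h *\<^sub>R v))) (at 0)"
    using mul_has_vector_derivative[OF
        conj_has_vector_derivative[OF c'[of t] c0, of "- (h *\<^sub>R z)"] c'[of h]]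
    unfolding eq by (simp add: c0)
  then show ?thesis
    using vector_derivative_unique_at[OF c'[of "t + h"]] dmul_split[of 0 0] by simp
qed

text \<open>This is the infinitesimal form of the cocycle identity: as \<open>h\<close> tends to 0,
  the conjugation contributes the bracket and the second summand contributes
  \<open>v\<close>.\<close>

lemma left_form_ray_derivative:
  "((\<lambda>t. left_form (t *\<^sub>R z) (t *\<^sub>R v)) has_vector_derivative
     v - brac z (left_form (t *\<^sub>R z) (t *\<^sub>R v))) (at t)"
proof -
  let ?w = "\<lambda>t. left_form (t *\<^sub>R z) (t *\<^sub>R v)"
  \<comment> \<open>By linearity the quotient of \<open>?w\<close> at 0 is
    \<open>left_form (h z) v\<close>, which tends to \<open>left_form 0 v = v\<close> because the
    differential of the product is continuous in the base point.\<close>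
  have w0: "(?w has_vector_derivative v) (at 0)"
  proof -
    have "continuous_on UNIV (\<lambda>h::real. left_form (h *\<^sub>R z) v)"
      unfolding left_form_def dmul_def
      by (intro continuous_on_frechet_derivative_apply[OF smooth] continuous_intros)
    then have "isCont (\<lambda>h::real. left_form (h *\<^sub>R z) v) 0"
      by (simp add: continuous_on_eq_continuous_at)
    moreover have "left_form 0 v = v"
      by (simp add: left_form_def)
    ultimately have "((\<lambda>h::real. left_form (h *\<^sub>R z) v) \<longlongrightarrow> v) (at 0)"
      by (simp add: isCont_def)
    then have "((\<lambda>h. (?w h - ?w 0) /\<^sub>R (h - 0)) \<longlongrightarrow> v) (at 0)"
    proof (rule Lim_transform_eventually)
      have "(?w h - ?w 0) /\<^sub>R (h - 0) = left_form (h *\<^sub>R z) v" if "h \<noteq> 0" for h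
        using that by (simp add: left_form_scale[symmetric]) (simp add: left_form_def)
      then show "\<forall>\<^sub>F h in at 0. left_form (h *\<^sub>R z) v = (?w h - ?w 0) /\<^sub>R (h - 0)"
        by (auto simp: eventually_at_filter)
    qed
    then show ?thesis
      by (simp add: has_vector_derivative_at_lim)
  qed
  \<comment> \<open>The cocycle conjugates by \<open>- (h z)\<close>, whence the reflection and the
    sign of the bracket.\<close>
  have "((\<lambda>h. conj_diff (h *\<^sub>R z) (?w t)) \<circ> uminus has_vector_derivative (-1) *\<^sub>R brac z (?w t)) (at (0::real))"
    by (rule vector_diff_chain_at) (use bracket_conj_diff[of z "?w t"] in \<open>auto intro!: derivative_eq_intros\<close>)
  then have "((\<lambda>h. conj_diff (- (h *\<^sub>R z)) (?w t) + ?w h) has_vector_derivative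
      - brac z (?w t) + v) (at 0)"
    using w0 by (intro has_vector_derivative_add) (simp_all add: o_def)
  then have "((\<lambda>h. ?w (t + h)) has_vector_derivative v - brac z (?w t)) (at 0)"
    by (simp add: left_form_cocycle)
  then show ?thesis
    by (rule has_vector_derivative_shift[THEN iffD1])
qed

text \<open>Both sides, extended along the ray through \<open>z\<close>, solve the same
  inhomogeneous linear equation with initial value 0. Their difference \<open>e\<close> satisfies
  the homogeneous equation and vanishes; \<open>t = 1\<close> gives the claim.\<close>

lemma left_form_hom:
  assumes "linear A" "\<And>x y. A (brac x y) = brac (A x) (A y)"
  shows "A (left_form z v) = left_form (A z) (A v)"
proof -
  define w where "w z v t = left_form (t *\<^sub>R z) (t *\<^sub>R v)" for z v t
  define e where "e t = A (w z v t) - w (A z) (A v) t" for t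
  have lin: "linear (brac z)" for z
    using bilinear by (simp add: bilinear_def)
  have w': "(w z v has_vector_derivative v - brac z (w z v t)) (at t)" for z v t
    unfolding w_def[abs_def] by (rule left_form_ray_derivative)
  have A: "bounded_linear A"
    using assms(1) by (rule linear_conv_bounded_linear[THEN iffD1])
  have eq: "A (v - brac z (w z v t)) - (A v - brac (A z) (w (A z) (A v) t)) = - brac (A z) (e t)" for t
    unfolding e_def using assms lin by (simp add: linear_diff)
  have "(e has_vector_derivative
      A (v - brac z (w z v t)) - (A v - brac (A z) (w (A z) (A v) t))) (at t)" for t
    unfolding e_def[abs_def]
    by (rule has_vector_derivative_diff[OF bounded_linear.has_vector_derivative[OF A w'] w'])
  then have "(e has_vector_derivative - brac (A z) (e t)) (at t)" for t
    unfolding eq .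
  moreover have "bounded_linear (\<lambda>x. - brac (A z) x)"
    using lin bounded_linear_minus linear_conv_bounded_linear by blast
  moreover have "e 0 = 0"
    using assms(1) by (simp add: e_def w_def left_form_def linear_0)
  ultimately have "e 1 = 0"
    by (intro linear_ode_zero[of "\<lambda>x. - brac (A z) x" e 1]) auto
  then show ?thesis
    by (simp add: e_def w_def)
qed

lemma left_trans_hom:
  assumes "linear A" "\<And>x y. A (brac x y) = brac (A x) (A y)"
  shows "A (left_trans z y) = left_trans (A z) (A y)"
proof -
  have "A y = left_form (A z) (A (left_trans z y))"
    using left_form_hom[OF assms, of z "left_trans z y"] by (simp add: left_form_left_trans)
  then show ?thesis
    by (simp add: left_trans_left_form)
qed

text \<open>A curve of constant left velocity w is u 0 * (t w): the derivative of u t * (- t w) vanishes.\<close>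

lemma constant_left_velocity:
  assumes "\<And>t. (u has_vector_derivative left_trans (u t) w) (at t)"
  shows "u t = u 0 \<odot> (t *\<^sub>R w)"
proof -
  define z where "z t = u t \<odot> (- (t *\<^sub>R w))" for t
  have "(z has_vector_derivative 0) (at t)" for t
  proof -
    have u: "((\<lambda>h. u (t + h)) has_vector_derivative left_trans (u t) w) (at 0)"
      using assms[of t] by (rule has_vector_derivative_shift[THEN iffD2])
    have v: "((\<lambda>h. h *\<^sub>R (- w)) has_vector_derivative - w) (at 0)"
      using has_vector_derivative_line[of 0 "- w" 0] by simp
    have "((\<lambda>h. u (t + h) \<odot> (h *\<^sub>R (- w))) has_vector_derivative 0) (at 0)"
    proof -
      have "left_trans (u t) w + left_trans (u t) (- w) = 0"
        using left_trans_linear[of "u t"] by (simp add: linear_neg)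
      then show ?thesis
        using mul_has_vector_derivative[OF u v] dmul_split[of "u t" 0 "left_trans (u t) w" "- w"]
        by (simp add: left_trans_def)
    qed
    from mul_has_vector_derivative[OF this has_vector_derivative_const, of "- (t *\<^sub>R w)"]
    have "((\<lambda>h. u (t + h) \<odot> (h *\<^sub>R (- w)) \<odot> (- (t *\<^sub>R w))) has_vector_derivative 0) (at 0)"
      by simp
    moreover have "u (t + h) \<odot> (h *\<^sub>R (- w)) \<odot> (- (t *\<^sub>R w)) = z (t + h)" for h
    proof -
      have "(h *\<^sub>R (- w)) \<odot> (- (t *\<^sub>R w)) = - ((t + h) *\<^sub>R w)"
        using line[of "- h" w "- t"] by (simp add: algebra_simps)
      then show ?thesis
        by (simp add: z_def assoc)
    qed
    ultimately show ?thesis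
      by - (rule has_vector_derivative_shift[THEN iffD1], simp)
  qed
  then obtain c where "\<And>t. z t = c"
    using has_vector_derivative_zero_constant[of UNIV z] by auto
  then have "z t \<odot> (t *\<^sub>R w) = z 0 \<odot> (t *\<^sub>R w)"
    by simp
  then show ?thesis
    by (simp add: z_def assoc)
qed

text \<open>Since \<open>A\<close> respects left translation of vectors, the image of the curve
  \<open>x \<odot> (t y)\<close> starts at \<open>A x\<close> and has constant left velocity
  \<open>A y\<close>, which determines it.\<close>

lemma lie_hom_imp_hom:
  assumes "linear A" "\<And>x y. A (brac x y) = brac (A x) (A y)"
  shows "A (x \<odot> y) = A x \<odot> A y"
proof -
  have "((\<lambda>t. A (x \<odot> (t *\<^sub>R y))) has_vector_derivative left_trans (A (x \<odot> (t *\<^sub>R y))) (A y)) (at t)" for t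
  proof -
    have "((\<lambda>h. (x \<odot> (t *\<^sub>R y)) \<odot> (0 + h *\<^sub>R y)) has_vector_derivative left_trans (x \<odot> (t *\<^sub>R y)) y) (at 0)"
      by (intro left_trans_has_vector_derivative has_vector_derivative_line) simp
    then have "((\<lambda>t. x \<odot> (t *\<^sub>R y)) has_vector_derivative left_trans (x \<odot> (t *\<^sub>R y)) y) (at t)"
      by - (rule has_vector_derivative_shift[THEN iffD1], simp add: assoc line)
    then have "((\<lambda>t. A (x \<odot> (t *\<^sub>R y))) has_vector_derivative A (left_trans (x \<odot> (t *\<^sub>R y)) y)) (at t)"
      using bounded_linear.has_vector_derivative linear_conv_bounded_linear[THEN iffD1, OF assms(1)]
      by blast
    then show ?thesis
      using left_trans_hom[OF assms] by simp
  qed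
  from constant_left_velocity[OF this, of 1] show ?thesis
    by simp
qed

text \<open>These are the left-invariant vector fields that annihilate \<phi>. Their flows are right
  translations.\<close>

definition invariance_algebra :: "('g \<Rightarrow> 'b::euclidean_space) \<Rightarrow> 'g set" where
  "invariance_algebra \<phi> = {y. \<forall>p. frechet_derivative \<phi> (at p) (left_trans p y) = 0}"

lemma derivative_along:
  fixes \<phi> :: "'g \<Rightarrow> 'b::euclidean_space"
  assumes "\<And>p. \<phi> differentiable (at p)" "(v has_vector_derivative v') (at t)" "v t = 0"
  shows "((\<lambda>s. \<phi> (p \<odot> v s)) has_vector_derivative frechet_derivative \<phi> (at p) (left_trans p v')) (at t)"
proof -
  have "(\<phi> has_derivative frechet_derivative \<phi> (at (p \<odot> v t))) (at (p \<odot> v t))"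
    using assms(1) frechet_derivative_works by blast
  from has_derivative_compose[OF left_trans_has_vector_derivative[OF assms(2,3), of p,
        unfolded has_vector_derivative_def] this]
  show ?thesis
    using linear_frechet_derivative[OF assms(1)]
    by (simp add: has_vector_derivative_def assms(3) linear_scale)
qed

lemma subspace_invariance_algebra:
  fixes \<phi> :: "'g \<Rightarrow> 'b::euclidean_space"
  assumes "\<And>p. \<phi> differentiable (at p)"
  shows "subspace (invariance_algebra \<phi>)"
proof -
  have "linear (\<lambda>y. frechet_derivative \<phi> (at p) (left_trans p y))" for p
    using linear_compose[OF left_trans_linear linear_frechet_derivative[OF assms]]
    by (simp add: o_def)
  from linear_0[OF this] linear_add[OF this] linear_scale[OF this] show ?thesis
    by (simp add: invariance_algebra_def subspace_def)
qed

lemma invariance_algebra_invariant: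
  fixes \<phi> :: "'g \<Rightarrow> 'b::euclidean_space"
  assumes "\<And>p. \<phi> differentiable (at p)" "y \<in> invariance_algebra \<phi>"
  shows "\<phi> (p \<odot> y) = \<phi> p"
proof -
  have "((\<lambda>t. \<phi> (p \<odot> (t *\<^sub>R y))) has_vector_derivative 0) (at t)" for t
  proof -
    have "((\<lambda>h. \<phi> ((p \<odot> (t *\<^sub>R y)) \<odot> (0 + h *\<^sub>R y))) has_vector_derivative
        frechet_derivative \<phi> (at (p \<odot> (t *\<^sub>R y))) (left_trans (p \<odot> (t *\<^sub>R y)) y)) (at 0)"
      by (intro derivative_along assms has_vector_derivative_line) simp
    then show ?thesis
      using assms(2)
      by - (rule has_vector_derivative_shift[THEN iffD1],
        simp add: invariance_algebra_def assoc line)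
  qed
  then obtain c where "\<And>t. \<phi> (p \<odot> (t *\<^sub>R y)) = c"
    using has_vector_derivative_zero_constant[of UNIV "\<lambda>t. \<phi> (p \<odot> (t *\<^sub>R y))"]
    by (auto simp: has_vector_derivative_at_within)
  from this[of 1] this[of 0] show ?thesis
    by simp
qed

text \<open>Right translations by \<open>t x\<close>, \<open>s y\<close> and \<open>- (t x)\<close>
  all leave \<phi> unchanged, so the conjugate direction \<open>conj_diff (t x) y\<close> is again
  one of invariance. The bracket is the derivative of these directions at \<open>t = 0\<close>, and
  a finite-dimensional subspace is closed.\<close>

lemma invariance_algebra_bracket:
  fixes \<phi> :: "'g \<Rightarrow> 'b::euclidean_space"
  assumes diff: "\<And>p. \<phi> differentiable (at p)"
    and x: "x \<in> invariance_algebra \<phi>" and y: "y \<in> invariance_algebra \<phi>"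
  shows "brac x y \<in> invariance_algebra \<phi>"
proof -
  let ?H = "invariance_algebra \<phi>"
  note sub = subspace_invariance_algebra[OF diff]
  note inv = invariance_algebra_invariant[OF diff]
  have conj: "conj_diff (t *\<^sub>R x) y \<in> ?H" for t
  proof -
    have tx: "t *\<^sub>R x \<in> ?H" "- (t *\<^sub>R x) \<in> ?H"
      using sub x by (simp_all add: subspace_scale subspace_neg)
    have "frechet_derivative \<phi> (at p) (left_trans p (conj_diff (t *\<^sub>R x) y)) = 0" for p
    proof -
      have "((\<lambda>s. ((t *\<^sub>R x) \<odot> (0 + s *\<^sub>R y)) \<odot> (- (t *\<^sub>R x))) has_vector_derivative
          conj_diff (t *\<^sub>R x) y) (at 0)"
        by (intro conj_has_vector_derivative has_vector_derivative_line) simp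
      from derivative_along[OF diff this, of p]
      have "((\<lambda>s. \<phi> (p \<odot> (((t *\<^sub>R x) \<odot> (0 + s *\<^sub>R y)) \<odot> (- (t *\<^sub>R x))))) has_vector_derivative
          frechet_derivative \<phi> (at p) (left_trans p (conj_diff (t *\<^sub>R x) y))) (at 0)"
        by simp
      moreover have "\<phi> (p \<odot> (((t *\<^sub>R x) \<odot> (0 + s *\<^sub>R y)) \<odot> (- (t *\<^sub>R x)))) = \<phi> p" for s
      proof -
        have "s *\<^sub>R y \<in> ?H"
          using sub y by (simp add: subspace_scale)
        then show ?thesis
          using inv[OF tx(1)] inv[OF tx(2)] inv by (simp flip: assoc)
      qed
      ultimately have "((\<lambda>s::real. \<phi> p) has_vector_derivative
          frechet_derivative \<phi> (at p) (left_trans p (conj_diff (t *\<^sub>R x) y))) (at 0)"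
        by simp
      then show ?thesis
        using vector_derivative_unique_at has_vector_derivative_const by blast
    qed
    then show ?thesis
      by (simp add: invariance_algebra_def)
  qed
  have "((\<lambda>t. (conj_diff (t *\<^sub>R x) y - conj_diff (0 *\<^sub>R x) y) /\<^sub>R t) \<longlongrightarrow> brac x y) (at 0)"
    using bracket_conj_diff[of x y] by (simp add: has_vector_derivative_at_lim)
  moreover have "(conj_diff (t *\<^sub>R x) y - conj_diff (0 *\<^sub>R x) y) /\<^sub>R t \<in> ?H" for t
    using sub conj by (intro subspace_scale subspace_diff)
  ultimately show ?thesis
    using Lim_in_closed_set[OF closed_subspace[OF sub], of _ "at (0::real)"]
    by (metis (no_types, lifting) always_eventually at_neq_bot)
qed

end

section \<open>Gradings and the finest decomposition\<close>

lemma component_dilation: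
  assumes "direct_sum {1..n} L UNIV" "i \<in> {1..n}"
  shows "component {1..n} L i (\<Sum>j=1..n. s ^ j *\<^sub>R component {1..n} L j x) = s ^ i *\<^sub>R component {1..n} L i x"
proof (rule component_sum[OF assms(1) _ assms(2)])
  fix j assume j: "j \<in> {1..n}"
  then have "subspace (L j)"
    using assms(1) by (simp add: direct_sum_def)
  then show "s ^ j *\<^sub>R component {1..n} L j x \<in> L j"
    using component_in[OF assms(1) UNIV_I j] subspace_scale by blast
qed

lemma component_eqI:
  assumes "direct_sum I V UNIV" "\<And>i. i \<in> I \<Longrightarrow> component I V i x = component I V i y"
  shows "x = y"
proof -
  have "(\<Sum>i\<in>I. component I V i x) = (\<Sum>i\<in>I. component I V i y)"
    using assms(2) by (rule sum.cong[OF refl])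
  then show ?thesis
    by (simp add: sum_component[OF assms(1) UNIV_I])
qed

text \<open>The layers are the eigenspaces of a dilation, whence a map commuting with it preserves them.\<close>

lemma component_commute:
  fixes L :: "nat \<Rightarrow> 'g::real_vector set"
  assumes ds: "direct_sum {1..n} L UNIV" and lin: "linear A"
    and dil: "\<And>x. A (\<Sum>j=1..n. 2 ^ j *\<^sub>R component {1..n} L j x)
      = (\<Sum>j=1..n. 2 ^ j *\<^sub>R component {1..n} L j (A x))"
    and i: "i \<in> {1..n}"
  shows "A (component {1..n} L i x) = component {1..n} L i (A x)"
proof -
  let ?C = "component {1..n} L"
  have layer: "A y \<in> L j" if j: "j \<in> {1..n}" and y: "y \<in> L j" for y j
  proof -
    have "(\<Sum>k=1..n. 2 ^ k *\<^sub>R ?C k y) = 2 ^ j *\<^sub>R y"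
    proof (rule component_eqI[OF ds])
      fix k assume k: "k \<in> {1..n}"
      have "?C k (2 ^ j *\<^sub>R y) = 2 ^ j *\<^sub>R ?C k y"
        using linear_component[OF ds k] by (simp add: linear_scale)
      then show "?C k (\<Sum>k=1..n. 2 ^ k *\<^sub>R ?C k y) = ?C k (2 ^ j *\<^sub>R y)"
        unfolding component_dilation[OF ds k] component_of_summand[OF ds y j k] by simp
    qed
    then have "(\<Sum>k=1..n. 2 ^ k *\<^sub>R ?C k (A y)) = 2 ^ j *\<^sub>R A y"
      using dil[of y] lin by (simp add: linear_scale)
    then have *: "2 ^ k *\<^sub>R ?C k (A y) = 2 ^ j *\<^sub>R ?C k (A y)" if "k \<in> {1..n}" for k
      using component_dilation[OF ds that, of 2 "A y"] linear_component[OF ds that]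
      by (auto simp: linear_scale simp del: One_nat_def)
    \<comment> \<open>The dilation by 2 separates the layers since the powers of 2 are
      distinct.\<close>
    have 0: "?C k (A y) = 0" if "k \<in> {1..n}" "k \<noteq> j" for k
      using *[OF that(1)] that(2) by simp
    note in_j = component_in[OF ds UNIV_I j, of "A y"]
    have "A y = ?C j (A y)"
    proof (rule component_eqI[OF ds])
      fix k assume k: "k \<in> {1..n}"
      show "?C k (A y) = ?C k (?C j (A y))"
        unfolding component_of_summand[OF ds in_j j k] using 0[OF k] by simp
    qed
    from this[symmetric] in_j show ?thesis
      by (simp only:)
  qed
  have "A (\<Sum>j=1..n. ?C j x) = (\<Sum>j=1..n. A (?C j x))"
    using lin by (rule linear_sum)
  then have "A x = (\<Sum>j=1..n. A (?C j x))"
    by (simp only: sum_component[OF ds UNIV_I])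
  then show ?thesis
    using component_sum[OF ds _ i, of "\<lambda>j. A (?C j x)"] layer component_in[OF ds UNIV_I] by simp
qed

text \<open>Every layer after the first is spanned by brackets of its predecessor with the first, so
  a subalgebra containing the first layer absorbs all of them in turn.\<close>

lemma stratified_algebra_generated:
  assumes "stratified_algebra b W L n" "subspace H" "L 1 \<subseteq> H" "\<And>x y. x \<in> H \<Longrightarrow> y \<in> H \<Longrightarrow> b x y \<in> H"
  shows "W \<subseteq> H"
proof
  fix x assume "x \<in> W"
  have layer: "Suc j \<le> n \<Longrightarrow> L (Suc j) \<subseteq> H" for j
  proof (induction j)
    case 0
    then show ?case using assms(3) by simp
  next
    case (Suc j)
    then have "{b x y |x y. x \<in> L (Suc j) \<and> y \<in> L 1} \<subseteq> H"
      using assms(3,4) by auto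
    then have "span {b x y |x y. x \<in> L (Suc j) \<and> y \<in> L 1} \<subseteq> H"
      using assms(2) span_minimal by blast
    moreover have "Suc j \<in> {1..n}"
      using Suc.prems by simp
    ultimately show ?case
      using assms(1) unfolding stratified_algebra_def by blast
  qed
  obtain c where c: "\<And>i. i \<in> {1..n} \<Longrightarrow> c i \<in> L i" "x = (\<Sum>i=1..n. c i)"
    using direct_sum_decompose[OF _ \<open>x \<in> W\<close>] assms(1) unfolding stratified_algebra_def by blast
  have LH: "L i \<subseteq> H" if "i \<in> {1..n}" for i
    using layer[of "i - 1"] that by simp
  show "x \<in> H"
    unfolding c(2) using assms(2)
  proof (rule subspace_sum)
    show "c i \<in> H" if "i \<in> {1..n}" for i
      using c(1)[OF that] LH[OF that] by blast
  qed
qed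

lemma stratified_algebra_component_closed:
  assumes str: "stratified_algebra b W (\<lambda>j. L j \<inter> W) k"
    and ds: "direct_sum {1..n} L UNIV" and top: "L (Suc n) = {0}" and bil: "bilinear b"
    and x: "x \<in> W" and i: "i \<in> {1..n}"
  shows "component {1..n} L i x \<in> W"
proof -
  have sub: "subspace W"
    using str by (simp add: stratified_algebra_def lie_subalgebra_def)
  have gen: "span {b x y |x y. x \<in> L j \<inter> W \<and> y \<in> L 1 \<inter> W} = L (Suc j) \<inter> W" if "j \<in> {1..k}" for j
    using str that unfolding stratified_algebra_def by blast
  have dsW: "direct_sum {1..k} (\<lambda>j. L j \<inter> W) W"
    using str unfolding stratified_algebra_def by blast
  \<comment> \<open>Nothing is assumed about \<open>L j\<close> beyond \<open>j = Suc n\<close>. If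
    \<open>k\<close> exceeded \<open>n\<close>, the layers of \<open>W\<close> from
    \<open>Suc n\<close> up to \<open>k\<close> would be generated by zero brackets, although the
    last layer of \<open>W\<close> is nonzero.\<close>
  have "k \<le> n"
  proof (rule ccontr)
    assume "\<not> k \<le> n"
    have "n + Suc d \<le> k \<Longrightarrow> L (n + Suc d) \<inter> W = {0}" for d
    proof (induction d)
      case 0
      then show ?case using top sub by (auto simp: subspace_0)
    next
      case (Suc d)
      then have 0: "L (n + Suc d) \<inter> W = {0}"
        by simp
      have "{b x y |x y. x \<in> L (n + Suc d) \<inter> W \<and> y \<in> L 1 \<inter> W} \<subseteq> {0}"
        unfolding 0 using bil by (auto simp: bilinear_lzero)
      then have "span {b x y |x y. x \<in> L (n + Suc d) \<inter> W \<and> y \<in> L 1 \<inter> W} \<subseteq> {0}"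
        by (rule span_minimal) (rule subspace_single_0)
      moreover have "n + Suc d \<in> {1..k}"
        using Suc.prems by simp
      ultimately have "L (Suc (n + Suc d)) \<inter> W \<subseteq> {0}" "0 \<in> L (Suc (n + Suc d)) \<inter> W"
        by (simp_all only: flip: gen) (simp add: span_0)
      then show ?case
        unfolding add_Suc_right by blast
    qed
    from this[of "k - Suc n"] have "L k \<inter> W = {0}"
      using \<open>\<not> k \<le> n\<close> by simp
    then show False
      using str by (simp add: stratified_algebra_def)
  qed
  obtain c where c: "\<And>i. i \<in> {1..k} \<Longrightarrow> c i \<in> L i \<inter> W" "x = (\<Sum>i=1..k. c i)"
    using direct_sum_decompose[OF dsW x] by blast
  \<comment> \<open>\<open>W\<close> may have smaller step than the whole algebra; the missing
    layers are filled with 0.\<close>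
  let ?c = "\<lambda>i. if i \<le> k then c i else 0"
  have subL: "subspace (L j)" if "j \<in> {1..n}" for j
    using ds that by (simp add: direct_sum_def)
  have "x = (\<Sum>i=1..n. ?c i)"
    unfolding c(2) using \<open>k \<le> n\<close> by (intro sum.mono_neutral_cong_left) auto
  moreover have "?c j \<in> L j \<inter> W" if "j \<in> {1..n}" for j
    using c(1)[of j] that subL[OF that] sub by (auto simp: subspace_0)
  ultimately show ?thesis
    using component_sum[OF ds _ i, of ?c] i by auto
qed

text \<open>The images of the summands form another decomposition into graded ideals, so each is a
  sum of summands indexed by a block of \<open>{1..m}\<close>. There are \<open>m\<close> disjoint
  blocks, none empty because no summand is zero; hence every block is a single index.\<close>

lemma finest_decomposition_permuted:
  assumes fin: "finest_decomposition b UNIV L n m V"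
    and ds: "direct_sum {1..n} L UNIV" and top: "L (Suc n) = {0}" and bil: "bilinear b"
    and lin: "linear A" "linear B" and BA: "\<And>x. B (A x) = x" and AB: "\<And>x. A (B x) = x"
    and hom: "\<And>x y. A (b x y) = b (A x) (A y)"
    and comm: "\<And>x j. j \<in> {1..n} \<Longrightarrow> A (component {1..n} L j x) = component {1..n} L j (A x)"
    and ideal: "\<And>k x y. k \<in> {1..m} \<Longrightarrow> y \<in> V k \<Longrightarrow> b x y \<in> V k"
  obtains \<sigma> where "\<sigma> permutes {1..m}" "\<And>k. k \<in> {1..m} \<Longrightarrow> A ` V k = V (\<sigma> k)"
proof -
  have dsV: "direct_sum {1..m} V UNIV"
    using fin by (simp add: finest_decomposition_def)
  have graded: "graded_ideal b UNIV L n (A ` V k)" if k: "k \<in> {1..m}" for k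
    unfolding graded_ideal_def
  proof (intro conjI ballI)
    obtain nk where str: "stratified_algebra b (V k) (\<lambda>j. L j \<inter> V k) nk"
      using fin k unfolding finest_decomposition_def by blast
    show "b x y \<in> A ` V k" if "y \<in> A ` V k" for x y
      using that ideal[OF k] hom AB by (metis (no_types, lifting) imageE imageI)
    show "direct_sum {1..n} (\<lambda>j. L j \<inter> A ` V k) (A ` V k)"
    proof (rule direct_sum_Int[OF ds])
      show "subspace (A ` V k)"
        using lin(1) dsV k by (auto simp: direct_sum_def intro: linear_subspace_image)
      fix x i assume "x \<in> A ` V k" and i: "i \<in> {1..n}"
      then obtain y where "y \<in> V k" "x = A y"
        by auto
      then show "component {1..n} L i x \<in> A ` V k"
        using stratified_algebra_component_closed[OF str ds top bil _ i] comm[OF i, of y]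
        by (metis imageI)
    qed
  qed simp_all
  have "\<forall>(q::nat) W. direct_sum {1..q} W UNIV \<and> (\<forall>l\<in>{1..q}. graded_ideal b UNIV L n (W l)) \<longrightarrow>
      (\<exists>I. disjoint_family_on I {1..q} \<and> (\<Union>l\<in>{1..q}. I l) = {1..m} \<and>
        (\<forall>l\<in>{1..q}. direct_sum (I l) V (W l)))"
    using fin unfolding finest_decomposition_def by (elim conjE)
  from this[rule_format, of m "\<lambda>k. A ` V k"] obtain I
    where I: "disjoint_family_on I {1..m}" "(\<Union>l\<in>{1..m}. I l) = {1..m}"
      "\<And>l. l \<in> {1..m} \<Longrightarrow> direct_sum (I l) V (A ` V l)"
    using graded direct_sum_linear_image[OF dsV lin BA AB] by metis
  have ne: "I l \<noteq> {}" if l: "l \<in> {1..m}" for l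
  proof
    assume "I l = {}"
    then have "A ` V l = {0}"
      using I(3)[OF l] by (simp add: direct_sum_def bij_betw_def)
    then have "V l \<subseteq> {B 0}"
      using BA by (metis (no_types, lifting) image_eqI singletonD singletonI subsetI)
    then have "V l \<subseteq> {0}"
      using lin(2) by (simp add: linear_0)
    moreover have "0 \<in> V l"
      using dsV l by (simp add: direct_sum_def subspace_0)
    ultimately have "V l = {0}"
      by blast
    then show False
      using fin l by (simp add: finest_decomposition_def)
  qed
  \<comment> \<open>Being the identity outside \<open>{1..m}\<close> is part of
    \<open>permutes\<close>.\<close>
  define s where "s l = (if l \<in> {1..m} then SOME i. i \<in> I l else l)" for l
  have s: "s l \<in> I l" if "l \<in> {1..m}" for l
    using ne[OF that] that by (simp add: s_def some_in_eq)
  have inj: "inj_on s {1..m}"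
  proof (rule inj_onI)
    fix k l assume "k \<in> {1..m}" "l \<in> {1..m}" "s k = s l"
    then show "k = l"
      using I(1) s unfolding disjoint_family_on_def by (metis disjoint_iff)
  qed
  have "s ` {1..m} \<subseteq> {1..m}"
    using I(2) s by blast
  then have surj: "s ` {1..m} = {1..m}"
    using inj by (simp add: endo_inj_surj)
  have perm: "s permutes {1..m}"
    using inj surj by (intro bij_imp_permutes) (auto simp: bij_betw_def s_def)
  have single: "I l = {s l}" if l: "l \<in> {1..m}" for l
  proof -
    have "i = s l" if i: "i \<in> I l" for i
    proof -
      have "i \<in> s ` {1..m}"
        using I(2) l i surj by auto
      then obtain k where "k \<in> {1..m}" "i = s k"
        by auto
      then show ?thesis
        using I(1) s i l unfolding disjoint_family_on_def by (metis disjoint_iff)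
    qed
    then show ?thesis
      using s[OF l] by blast
  qed
  have "A ` V l = V (s l)" if l: "l \<in> {1..m}" for l
  proof -
    have *: "direct_sum {s l} V (A ` V l)"
      using I(3)[OF l] single[OF l] by simp
    have "x \<in> V (s l)" if "x \<in> A ` V l" for x
      using direct_sum_decompose[OF * that] by auto
    moreover have "x \<in> A ` V l" if "x \<in> V (s l)" for x
    proof -
      have "(\<lambda>i\<in>{s l}. x) \<in> (\<Pi>\<^sub>E i\<in>{s l}. V i)"
        using that by auto
      then have "(\<Sum>i\<in>{s l}. (\<lambda>i\<in>{s l}. x) i) \<in> (\<lambda>c. \<Sum>i\<in>{s l}. c i) ` (\<Pi>\<^sub>E i\<in>{s l}. V i)"
        by (rule imageI)
      then show ?thesis
        using * by (simp add: direct_sum_def bij_betw_def)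
    qed
    ultimately show ?thesis
      by blast
  qed
  with perm show ?thesis
    using that by blast
qed

section \<open>Stratified groups in the logarithmic chart\<close>

locale stratified_chart =
  fixes G :: "('p, 'g::euclidean_space) stratified_data"
  assumes stratified: "stratified_group G"
begin

abbreviation C :: "nat \<Rightarrow> 'g \<Rightarrow> 'g" where
  "C \<equiv> component {1..step G} (layer G)"

lemma group: "group G"
  and bij_Exp: "bij_betw (Exp G) UNIV (carrier G)"
  and bilinear_brak: "bilinear (brak G)"
  and layers: "direct_sum {1..step G} (layer G) UNIV"
  and top_layer: "layer G (Suc (step G)) = {0}"
  using stratified
  by (simp_all add: stratified_group_def exponential_lie_group_def lie_bracket_def
      stratified_algebra_def)

lemma Exp_in [simp]: "Exp G x \<in> carrier G"
  using bij_Exp by (auto simp: bij_betw_def)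

lemma Log_Exp [simp]: "Log G (Exp G x) = x"
  using bij_Exp by (simp add: Log_def bij_betw_def)

lemma Exp_Log [simp]: "p \<in> carrier G \<Longrightarrow> Exp G (Log G p) = p"
  using bij_Exp by (simp add: Log_def bij_betw_def f_inv_into_f)

lemma Log_image [simp]: "Log G ` carrier G = UNIV"
proof -
  have "x \<in> Log G ` carrier G" for x
    by (rule image_eqI[of _ _ "Exp G x"]) auto
  then show ?thesis by auto
qed

definition mul :: "'g \<Rightarrow> 'g \<Rightarrow> 'g" where
  "mul x y = Log G (Exp G x \<otimes>\<^bsub>G\<^esub> Exp G y)"

lemma Exp_mul: "Exp G (mul x y) = Exp G x \<otimes>\<^bsub>G\<^esub> Exp G y"
  using group by (simp add: mul_def group.is_monoid monoid.m_closed)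

lemma Exp_line: "Exp G (s *\<^sub>R x) \<otimes>\<^bsub>G\<^esub> Exp G (t *\<^sub>R x) = Exp G ((s + t) *\<^sub>R x)"
  using stratified by (simp add: stratified_group_def exponential_lie_group_def)

lemma Exp_0 [simp]: "Exp G 0 = \<one>\<^bsub>G\<^esub>"
proof -
  interpret group G by (rule group)
  show ?thesis
    using Exp_line[of 0 0 0] by (simp add: r_cancel_one)
qed

lemma Log_one [simp]: "Log G \<one>\<^bsub>G\<^esub> = 0"
  by (metis Exp_0 Log_Exp)

lemma inv_Exp [simp]: "inv\<^bsub>G\<^esub> (Exp G x) = Exp G (- x)"
proof -
  interpret group G by (rule group)
  show ?thesis
    using Exp_line[of "-1" x 1] by (intro inv_equality) auto
qed

sublocale exponential_law mul "brak G"
proof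
  interpret group G by (rule group)
  show "mul (mul x y) z = mul x (mul y z)" for x y z
    by (simp add: mul_def m_assoc)
  show "mul 0 x = x" "mul x 0 = x" for x
    by (simp_all add: mul_def)
  show "mul (s *\<^sub>R x) (t *\<^sub>R x) = (s + t) *\<^sub>R x" for s t x
    by (simp add: mul_def Exp_line)
  show "smooth_on UNIV (\<lambda>(x, y). mul x y)"
    using stratified by (simp add: mul_def stratified_group_def exponential_lie_group_def)
  show "bilinear (brak G)"
    by (rule bilinear_brak)
  have "Ad G (Exp G z) y = vector_derivative (\<lambda>s. mul (mul z (s *\<^sub>R y)) (- z)) (at 0)" for z y
    by (simp add: Ad_def mul_def)
  moreover have "((\<lambda>t. Ad G (Exp G (t *\<^sub>R x)) y) has_vector_derivative brak G x y) (at 0)" for x y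
    using stratified by (simp add: stratified_group_def exponential_lie_group_def)
  ultimately show "((\<lambda>t. vector_derivative (\<lambda>s. mul (mul (t *\<^sub>R x) (s *\<^sub>R y)) (- (t *\<^sub>R x))) (at 0))
      has_vector_derivative brak G x y) (at 0)" for x y
    by simp
qed

section \<open>Dilations and graded automorphisms\<close>

lemma component_dil: "i \<in> {1..step G} \<Longrightarrow> C i (dil G s x) = s ^ i *\<^sub>R C i x"
  unfolding dil_def by (rule component_dilation[OF layers])

lemma step_pos: "1 \<in> {1..step G}"
proof (rule ccontr)
  assume "1 \<notin> {1..step G}"
  then have "{1..step G} = {}"
    by auto
  then have "(UNIV::'g set) = {0}"
    using layers by (simp add: direct_sum_def bij_betw_def)
  then have "dim (UNIV::'g set) = 0"
    by (metis dim_eq_0 order_refl)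
  then show False
    using stratified by (simp add: stratified_group_def stratified_algebra_def)
qed

lemma dil_first_layer:
  assumes "x \<in> layer G 1"
  shows "dil G s x = s *\<^sub>R x"
proof (rule component_eqI[OF layers])
  fix i assume i: "i \<in> {1..step G}"
  show "C i (dil G s x) = C i (s *\<^sub>R x)"
    unfolding component_dil[OF i] linear_scale[OF linear_component[OF layers i]]
      component_of_summand[OF layers assms step_pos i] by simp
qed

lemma lie_aut_component:
  assumes "A \<in> lie_aut_dil G" "i \<in> {1..step G}"
  shows "A (C i x) = C i (A x)"
proof (rule component_commute[OF layers _ _ assms(2)])
  show "linear A"
    using assms by (simp add: lie_aut_dil_def)
  show "A (\<Sum>j=1..step G. 2 ^ j *\<^sub>R C j x) = (\<Sum>j=1..step G. 2 ^ j *\<^sub>R C j (A x))" for x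
    using assms unfolding lie_aut_dil_def dil_def by simp
qed

lemma lie_aut_first_layer:
  assumes "A \<in> lie_aut_dil G" "x \<in> layer G 1"
  shows "A x \<in> layer G 1"
proof -
  have "C 1 x = x"
    using component_of_summand[OF layers assms(2) step_pos step_pos] by simp
  then have "A x = C 1 (A x)"
    using lie_aut_component[OF assms(1) step_pos, of x] by simp
  then show ?thesis
    using component_in[OF layers UNIV_I step_pos] by metis
qed

lemma lie_aut_inverse:
  assumes "A \<in> lie_aut_dil G"
  obtains B where "B \<in> lie_aut_dil G" "\<And>x. B (A x) = x" "\<And>x. A (B x) = x"
proof -
  define B where "B = inv_into UNIV A"
  have lin: "linear A" and bij: "bij A" and hom: "\<And>x y. A (brak G x y) = brak G (A x) (A y)"
    and dil: "\<And>s x. s > 0 \<Longrightarrow> A (dil G s x) = dil G s (A x)"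
    using assms by (auto simp: lie_aut_dil_def)
  have BA: "B (A x) = x" and AB: "A (B x) = x" for x
    using bij by (simp_all add: B_def bij_is_inj bij_is_surj surj_f_inv_f)
  have "linear B"
    unfolding B_def using lin bij_is_inj[OF bij] by (rule inj_linear_imp_inv_linear)
  moreover have "bij B"
    using AB BA by (intro o_bij[of A]) auto
  moreover have "B (brak G x y) = brak G (B x) (B y)" for x y
    using hom AB BA by metis
  moreover have "B (dil G s x) = dil G s (B x)" if "s > 0" for s x
    using dil[OF that] AB BA by metis
  ultimately have "B \<in> lie_aut_dil G"
    by (simp add: lie_aut_dil_def)
  then show ?thesis
    using that BA AB by blast
qed

lemma lie_aut_compose:
  assumes "A \<in> lie_aut_dil G" "B \<in> lie_aut_dil G"
  shows "(\<lambda>x. B (A x)) \<in> lie_aut_dil G"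
  using assms linear_compose[of A B] bij_comp[of A B] by (simp add: lie_aut_dil_def o_def)

lemma lie_aut_mul:
  assumes "A \<in> lie_aut_dil G"
  shows "A (mul x y) = mul (A x) (A y)"
  using assms by (intro lie_hom_imp_hom) (simp_all add: lie_aut_dil_def)

lemma lie_aut_bounded_linear: "A \<in> lie_aut_dil G \<Longrightarrow> bounded_linear A"
  by (simp add: lie_aut_dil_def linear_conv_bounded_linear)

lemma group_aut_of_lie_aut:
  assumes "A \<in> lie_aut_dil G"
  shows "Exp G \<circ> A \<circ> Log G \<in> group_aut_dil G"
proof -
  let ?T = "Exp G \<circ> A \<circ> Log G"
  interpret group G by (rule group)
  obtain B where B: "B \<in> lie_aut_dil G" "\<And>x. B (A x) = x" "\<And>x. A (B x) = x"
    using lie_aut_inverse[OF assms] by blast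
  have inj: "inj_on ?T (carrier G)"
    by (rule inj_onI) (metis B(2) Exp_Log Log_Exp comp_apply)
  have img: "p \<in> ?T ` carrier G" if "p \<in> carrier G" for p
    by (rule image_eqI[of _ _ "Exp G (B (Log G p))"]) (use that in \<open>simp_all add: B(3)\<close>)
  have bij: "bij_betw ?T (carrier G) (carrier G)"
    unfolding bij_betw_def using inj img by auto
  have inverse: "inv_into (carrier G) ?T (Exp G x) = Exp G (B x)" for x
    by (rule inv_into_f_eq[OF inj]) (simp_all add: B(3))
  have "?T \<in> hom G G"
  proof (rule homI)
    fix p q assume "p \<in> carrier G" "q \<in> carrier G"
    then show "?T (p \<otimes>\<^bsub>G\<^esub> q) = ?T p \<otimes>\<^bsub>G\<^esub> ?T q"
      using lie_aut_mul[OF assms, of "Log G p" "Log G q"]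
      by (simp flip: Exp_mul) (simp add: mul_def)
  qed simp
  then have "?T \<in> iso G G"
    using bij by (simp add: iso_def)
  moreover have "group_diffeo G (carrier G) (carrier G) ?T"
  proof -
    have "Log G \<circ> ?T \<circ> Exp G = A" "Log G \<circ> inv_into (carrier G) ?T \<circ> Exp G = B"
      by (simp_all only: fun_eq_iff comp_apply inverse Log_Exp simp_thms)
    then show ?thesis
      using bij lie_aut_bounded_linear[OF assms] lie_aut_bounded_linear[OF B(1)]
      by (simp add: group_diffeo_def smooth_on_def times_differentiable_on_bounded_linear)
  qed
  moreover have "?T (group_dil G s p) = group_dil G s (?T p)" if "s > 0" "p \<in> carrier G" for s p
    using assms that by (simp add: group_dil_def lie_aut_dil_def)
  ultimately show ?thesis
    by (simp add: group_aut_dil_def)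
qed

text \<open>The differential of f at p, with both tangent spaces translated back to the identity.\<close>

definition left_diff :: "('g \<Rightarrow> 'g) \<Rightarrow> 'g \<Rightarrow> 'g \<Rightarrow> 'g" where
  "left_diff f p y = left_form (f p) (frechet_derivative f (at p) (left_trans p y))"

lemma left_diff_has_vector_derivative:
  assumes "\<And>p. f differentiable (at p)"
  shows "((\<lambda>s. mul (- f p) (f (mul p (s *\<^sub>R y)))) has_vector_derivative left_diff f p y) (at 0)"
proof -
  have "((\<lambda>s. f (mul p (0 + s *\<^sub>R y))) has_vector_derivative
      frechet_derivative f (at p) (left_trans p y)) (at 0)"
    by (rule derivative_along[OF assms has_vector_derivative_line]) simp
  from mul_has_vector_derivative[OF has_vector_derivative_const[of "- f p"] this]
  show ?thesis
    by (simp add: left_diff_def left_form_def)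
qed

lemma continuous_left_diff:
  assumes "smooth_on UNIV f"
  shows "continuous_on UNIV (\<lambda>p. left_diff f p y)"
proof -
  have "continuous_on UNIV f"
    using assms by (metis smooth_on_def times_differentiable_on.simps(1))
  then show ?thesis
    unfolding left_diff_def left_form_def left_trans_def dmul_def
    by (intro continuous_on_frechet_derivative_apply[OF smooth]
        continuous_on_frechet_derivative_apply[OF assms] continuous_intros)
qed

text \<open>On the first layer, where dilations are scalar, the Pansu differential is the ordinary one:
  the higher components of the difference quotient vanish in the limit.\<close>

lemma left_diff_eq_pansu:
  assumes diff: "\<And>p. f differentiable (at p)"
    and lim: "((\<lambda>s. dil G (1 / s) (mul (- f p) (f (mul p (dil G s y))))) \<longlongrightarrow> z) (at_right 0)"
    and y: "y \<in> layer G 1" and z: "z \<in> layer G 1"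
  shows "left_diff f p y = z"
proof (rule component_eqI[OF layers])
  fix i assume i: "i \<in> {1..step G}"
  let ?c = "\<lambda>s. mul (- f p) (f (mul p (s *\<^sub>R y)))"
  note lin = linear_component[OF layers i]
  have bl: "bounded_linear (C i)"
    using lin by (simp add: linear_conv_bounded_linear)
  have "((\<lambda>s. ?c s /\<^sub>R s) \<longlongrightarrow> left_diff f p y) (at 0)"
    using left_diff_has_vector_derivative[OF diff, where p = p and y = y]
    unfolding has_vector_derivative_at_lim by simp
  then have "((\<lambda>s. ?c s /\<^sub>R s) \<longlongrightarrow> left_diff f p y) (at_right 0)"
    by (rule filterlim_mono) (simp_all add: at_le)
  then have l1: "((\<lambda>s. C i (?c s /\<^sub>R s)) \<longlongrightarrow> C i (left_diff f p y)) (at_right 0)"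
    by (rule bounded_linear.tendsto[OF bl])
  have "((\<lambda>s. s ^ (i - 1) *\<^sub>R C i (dil G (1 / s) (mul (- f p) (f (mul p (dil G s y))))))
      \<longlongrightarrow> 0 ^ (i - 1) *\<^sub>R C i z) (at_right (0::real))"
    by (intro tendsto_intros bounded_linear.tendsto[OF bl] lim)
  then have l2: "((\<lambda>s. C i (?c s /\<^sub>R s)) \<longlongrightarrow> 0 ^ (i - 1) *\<^sub>R C i z) (at_right 0)"
  proof (rule Lim_transform_eventually)
    \<comment> \<open>The dilation divides the component \<open>i\<close> by \<open>s ^ i\<close>;
      the factor \<open>s ^ (i - 1)\<close> leaves the single power of \<open>s\<close> of the
      ordinary quotient.\<close>
    have "s ^ (i - 1) *\<^sub>R C i (dil G (1 / s) (mul (- f p) (f (mul p (dil G s y))))) = C i (?c s /\<^sub>R s)"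
      if "s > 0" for s
    proof -
      have "s ^ (i - 1) * (1 / s) ^ i = inverse s"
        using that i by (cases i) (auto simp: field_simps)
      then show ?thesis
        by (simp add: component_dil[OF i] dil_first_layer[OF y] linear_scale[OF lin] del: One_nat_def)
    qed
    then show "\<forall>\<^sub>F s in at_right 0. s ^ (i - 1) *\<^sub>R C i (dil G (1 / s) (mul (- f p) (f (mul p (dil G s y)))))
        = C i (?c s /\<^sub>R s)"
      by (simp add: eventually_at_filter)
  qed
  have "C i (left_diff f p y) = 0 ^ (i - 1) *\<^sub>R C i z"
    using tendsto_unique[OF _ l1 l2] by simp
  \<comment> \<open>For \<open>i = 1\<close> the coefficient is \<open>0 ^ 0 = 1\<close>; for larger
    \<open>i\<close> both sides vanish since \<open>z\<close> is in the first layer.\<close>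
  moreover have "0 ^ (i - 1) *\<^sub>R C i z = C i z"
    using component_of_summand[OF layers z step_pos i] i by (cases "i = 1") auto
  ultimately show "C i (left_diff f p y) = C i z"
    by simp
qed

definition chart_map :: "('p \<Rightarrow> 'p) \<Rightarrow> 'g \<Rightarrow> 'g" where
  "chart_map f = Log G \<circ> f \<circ> Exp G"

lemma has_pansu_derivative_chart:
  assumes "f \<in> carrier G \<rightarrow> carrier G"
  shows "has_pansu_derivative G f (Exp G p) D \<longleftrightarrow>
    D \<in> carrier G \<rightarrow> carrier G \<and>
    (\<forall>K. compact K \<longrightarrow> uniform_limit K
       (\<lambda>s x. dil G (1 / s) (mul (- chart_map f p) (chart_map f (mul p (dil G s x)))))
       (chart_map D) (at_right 0))"
proof -
  interpret group G by (rule group)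
  have "Log G (group_dil G (1 / s) (inv\<^bsub>G\<^esub> (f (Exp G p)) \<otimes>\<^bsub>G\<^esub> f (Exp G p \<otimes>\<^bsub>G\<^esub> group_dil G s (Exp G x))))
      = dil G (1 / s) (mul (- chart_map f p) (chart_map f (mul p (dil G s x))))" for s x
  proof -
    have 1: "f (Exp G y) = Exp G (chart_map f y)" for y
      using assms by (auto simp: chart_map_def Pi_iff)
    have 2: "f (Exp G p \<otimes>\<^bsub>G\<^esub> Exp G y) = Exp G (chart_map f (mul p y))" for y
      by (simp flip: 1 add: Exp_mul)
    show ?thesis
      by (simp add: group_dil_def 1 2 mul_def[of "- chart_map f p"])
  qed
  then show ?thesis
    by (simp add: has_pansu_derivative_def chart_map_def o_def)
qed

end

section \<open>Factors\<close>

locale factored_chart = stratified_chart G for G :: "('p, 'g::euclidean_space) stratified_data" +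
  fixes m :: nat and V :: "nat \<Rightarrow> 'g set"
  assumes finest: "finest_decomposition (brak G) UNIV (layer G) (step G) m V"
begin

abbreviation P :: "nat \<Rightarrow> 'g \<Rightarrow> 'g" where
  "P \<equiv> component {1..m} V"

lemma factors: "direct_sum {1..m} V UNIV"
  using finest by (simp add: finest_decomposition_def)

lemma factor_stratified:
  assumes "k \<in> {1..m}"
  obtains n where "stratified_algebra (brak G) (V k) (\<lambda>j. layer G j \<inter> V k) n"
  using finest assms unfolding finest_decomposition_def by blast

lemma factors_commute:
  "\<lbrakk>j \<in> {1..m}; k \<in> {1..m}; j \<noteq> k; x \<in> V j; y \<in> V k\<rbrakk> \<Longrightarrow> brak G x y = 0"
  using finest unfolding finest_decomposition_def by blast

lemma subspace_factor: "k \<in> {1..m} \<Longrightarrow> subspace (V k)"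
  using factors by (simp add: direct_sum_def)

lemma brak_lin: "linear (brak G x)" "linear (\<lambda>x. brak G x y)"
  using bilinear_brak by (simp_all add: bilinear_def)

lemma brak_factor_right:
  assumes k: "k \<in> {1..m}" and x: "x \<in> V k"
  shows "brak G x y = brak G x (P k y)"
proof -
  have "brak G x y = brak G x (\<Sum>j=1..m. P j y)"
    by (simp only: sum_component[OF factors UNIV_I])
  also have "\<dots> = (\<Sum>j=1..m. brak G x (P j y))"
    by (rule linear_sum[OF brak_lin(1)])
  also have "\<dots> = (\<Sum>j=1..m. if j = k then brak G x (P k y) else 0)"
    using factors_commute[OF k _ _ x] component_in[OF factors UNIV_I] by (intro sum.cong) auto
  also have "\<dots> = brak G x (P k y)"
    using k by simp
  finally show ?thesis .
qed

lemma brak_factor_in: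
  assumes k: "k \<in> {1..m}" and x: "x \<in> V k"
  shows "brak G x y \<in> V k"
proof -
  obtain n where "stratified_algebra (brak G) (V k) (\<lambda>j. layer G j \<inter> V k) n"
    using factor_stratified[OF k] by blast
  then have "brak G x (P k y) \<in> V k"
    using x component_in[OF factors UNIV_I k] unfolding stratified_algebra_def lie_subalgebra_def by blast
  then show ?thesis
    by (subst brak_factor_right[OF k x])
qed

lemma factor_ideal:
  assumes "k \<in> {1..m}" "y \<in> V k"
  shows "brak G x y \<in> V k"
proof -
  have "brak G (x + y) (x + y) = 0" "brak G x x = 0" "brak G y y = 0"
    using stratified by (simp_all add: stratified_group_def lie_bracket_def)
  then have "brak G x y = - brak G y x"
    using linear_add[OF brak_lin(1)] linear_add[OF brak_lin(2)] by (simp add: add_eq_0_iff2)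
  then show ?thesis
    using brak_factor_in[OF assms, of x] subspace_factor[OF assms(1)] by (simp add: subspace_neg)
qed

text \<open>Expanding \<open>x\<close> over the factors splits the bracket into summands lying in
  the respective factors, and the summand in \<open>V k\<close> sees only the component
  \<open>P k y\<close>.\<close>

lemma projection_brak:
  assumes k: "k \<in> {1..m}"
  shows "P k (brak G x y) = brak G (P k x) (P k y)"
proof -
  have "brak G x y = brak G (\<Sum>j=1..m. P j x) y"
    by (simp only: sum_component[OF factors UNIV_I])
  also have "\<dots> = (\<Sum>j=1..m. brak G (P j x) y)"
    by (rule linear_sum[OF brak_lin(2)])
  finally have "P k (brak G x y) = P k (\<Sum>j=1..m. brak G (P j x) y)"
    by (rule arg_cong)
  also have "\<dots> = brak G (P k x) y"
    by (intro component_sum[OF factors _ k] brak_factor_in component_in[OF factors UNIV_I])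
  also have "\<dots> = brak G (P k x) (P k y)"
    by (rule brak_factor_right[OF k component_in[OF factors UNIV_I k]])
  finally show ?thesis .
qed

lemma linear_projection: "k \<in> {1..m} \<Longrightarrow> linear (P k)"
  by (rule linear_component[OF factors])

lemma projection_mul: "k \<in> {1..m} \<Longrightarrow> P k (mul x y) = mul (P k x) (P k y)"
  by (rule lie_hom_imp_hom[OF linear_projection projection_brak])

lemma projection_projection: "k \<in> {1..m} \<Longrightarrow> P k (P k x) = P k x"
  using component_of_summand[OF factors component_in[OF factors UNIV_I], of k k] by simp

text \<open>A factor with trivial first layer would be generated by 0, hence zero.\<close>

lemma first_layer_factor:
  assumes k: "k \<in> {1..m}"
  obtains y where "y \<in> V k" "y \<in> layer G 1" "y \<noteq> 0"
proof -
  have False if "\<not> (\<exists>y. y \<in> V k \<and> y \<in> layer G 1 \<and> y \<noteq> 0)"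
  proof -
    obtain n where str: "stratified_algebra (brak G) (V k) (\<lambda>j. layer G j \<inter> V k) n"
      using factor_stratified[OF k] by blast
    have "V k \<subseteq> {0}"
      using that linear_0[OF brak_lin(1)]
      by (intro stratified_algebra_generated[OF str subspace_single_0]) auto
    then have "V k = {0}"
      using subspace_0[OF subspace_factor[OF k]] by blast
    then show False
      using finest k unfolding finest_decomposition_def by blast
  qed
  then show ?thesis
    using that by blast
qed

lemma lie_aut_permutes:
  assumes "A \<in> lie_aut_dil G"
  obtains \<sigma> where "\<sigma> permutes {1..m}" "\<And>k. k \<in> {1..m} \<Longrightarrow> A ` V k = V (\<sigma> k)"
proof -
  obtain B where B: "B \<in> lie_aut_dil G" "\<And>x. B (A x) = x" "\<And>x. A (B x) = x"
    using lie_aut_inverse[OF assms] by blast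
  show ?thesis
  proof (rule finest_decomposition_permuted[OF finest layers top_layer bilinear_brak _ _ B(2,3)])
    show "linear A" "linear B" "A (brak G x y) = brak G (A x) (A y)" for x y
      using assms B(1) by (simp_all add: lie_aut_dil_def)
    show "A (C j x) = C j (A x)" if "j \<in> {1..step G}" for x j
      by (rule lie_aut_component[OF assms that])
    show "brak G x y \<in> V k" if "k \<in> {1..m}" "y \<in> V k" for k x y
      by (rule factor_ideal[OF that])
  qed (rule that)
qed

text \<open>The permutation induced at p is read off the nonvanishing component of the image of a fixed
  vector of the first layer, which depends continuously on p.\<close>

lemma permutation_constant:
  assumes perm: "\<And>p. \<sigma> p permutes {1..m}"
    and img: "\<And>p k. k \<in> {1..m} \<Longrightarrow> A p ` V k = V (\<sigma> p k)"
    and inj: "\<And>p. linear (A p)" "\<And>p. inj (A p)"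
    and cont: "\<And>y. y \<in> layer G 1 \<Longrightarrow> continuous_on UNIV (\<lambda>p::'g. A p y)"
    and k: "k \<in> {1..m}"
  shows "\<sigma> p k = \<sigma> q k"
proof -
  obtain y where y: "y \<in> V k" "y \<in> layer G 1" "y \<noteq> 0"
    using first_layer_factor[OF k] by blast
  have in_m: "\<sigma> p k \<in> {1..m}" for p
    using perm k by (metis permutes_in_image)
  have ne: "A p y \<noteq> 0" for p
    using inj[of p] y(3) by (metis injD linear_0)
  have Ay: "A p y \<in> V (\<sigma> p k)" for p
    using img[OF k] y(1) by blast
  have iff: "P l (A p y) \<noteq> 0 \<longleftrightarrow> \<sigma> p k = l" if "l \<in> {1..m}" for l p
    unfolding component_of_summand[OF factors Ay in_m that] using ne by auto
  have op: "open {p. \<sigma> p k = l}" if l: "l \<in> {1..m}" for l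
  proof -
    have "bounded_linear (P l)"
      using linear_projection[OF l] by (simp add: linear_conv_bounded_linear)
    then have "continuous_on UNIV (\<lambda>p. P l (A p y))"
      using cont[OF y(2)] by (rule bounded_linear.continuous_on)
    then have "open {p. P l (A p y) \<noteq> 0}"
      by (intro open_Collect_neq continuous_on_const)
    then show ?thesis
      by (simp only: iff[OF l])
  qed
  \<comment> \<open>With finitely many possible values, each taken on an open set, this set is also
    closed, and the whole space is connected.\<close>
  let ?S = "{r. \<sigma> r k = \<sigma> q k}"
  have "- ?S = (\<Union>l\<in>{1..m} - {\<sigma> q k}. {r. \<sigma> r k = l})"
    using in_m by auto
  moreover have "open (\<Union>l\<in>{1..m} - {\<sigma> q k}. {r. \<sigma> r k = l})"
    using op by (intro open_UN) blast
  ultimately have "closed ?S"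
    by (simp only: closed_def)
  with op[OF in_m[of q]] have "?S = {} \<or> ?S = UNIV"
    by (simp only: flip: clopen)
  moreover have "q \<in> ?S"
    by simp
  ultimately have "p \<in> ?S"
    by blast
  then show ?thesis
    by simp
qed

text \<open>The component of F in the factor k is invariant under right translation by the other factors,
  because the directions of invariance form a Lie algebra that contains their first layers.\<close>

lemma factor_component:
  assumes diff: "\<And>p. F differentiable (at p)"
    and pres: "\<And>p j y. j \<in> {1..m} \<Longrightarrow> y \<in> V j \<Longrightarrow> y \<in> layer G 1 \<Longrightarrow> left_diff F p y \<in> V j"
    and k: "k \<in> {1..m}"
  shows "P k (F x) = P k (F (P k x))"
proof -
  let ?\<phi> = "\<lambda>x. P k (F x)"
  let ?H = "invariance_algebra ?\<phi>"
  have bl: "bounded_linear (P k)"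
    using linear_projection[OF k] by (simp add: linear_conv_bounded_linear)
  have d: "(?\<phi> has_derivative (\<lambda>v. P k (frechet_derivative F (at p) v))) (at p)" for p
    using diff[of p] unfolding frechet_derivative_works by (rule bounded_linear.has_derivative[OF bl])
  have \<phi>_diff: "?\<phi> differentiable (at p)" for p
    using d[of p] by (rule differentiableI)
  have fd: "frechet_derivative ?\<phi> (at p) = (\<lambda>v. P k (frechet_derivative F (at p) v))" for p
    using frechet_derivative_at[OF d[of p]] by simp
  note sub = subspace_invariance_algebra[OF \<phi>_diff]
  have VH: "V j \<subseteq> ?H" if j: "j \<in> {1..m}" "j \<noteq> k" for j
  proof -
    obtain n where str: "stratified_algebra (brak G) (V j) (\<lambda>i. layer G i \<inter> V j) n"
      using factor_stratified[OF j(1)] by blast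
    have "layer G 1 \<inter> V j \<subseteq> ?H"
    proof
      fix y assume y: "y \<in> layer G 1 \<inter> V j"
      have "P k (frechet_derivative F (at p) (left_trans p y)) = 0" for p
      proof -
        have "left_diff F p y \<in> V j"
          using y by (intro pres[OF j(1)]) auto
        then have "P k (left_diff F p y) = 0"
          using component_of_summand[OF factors _ j(1) k] j(2) by simp
        \<comment> \<open>\<open>P k\<close> is a homomorphism, so it commutes with left translation
          of vectors; what it must kill is therefore the translated differential, which lies in the
          other factor \<open>V j\<close>.\<close>
        moreover have "P k (frechet_derivative F (at p) (left_trans p y))
            = left_trans (P k (F p)) (P k (left_diff F p y))"
          using left_trans_hom[OF linear_projection[OF k] projection_brak[OF k],
              of "F p" "left_diff F p y"]
          by (simp only: left_diff_def left_trans_left_form)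
        ultimately show ?thesis
          using linear_0[OF left_trans_linear] by simp
      qed
      then show "y \<in> ?H"
        by (simp only: invariance_algebra_def fd mem_Collect_eq simp_thms)
    qed
    then show ?thesis
      using invariance_algebra_bracket[OF \<phi>_diff]
      by (intro stratified_algebra_generated[OF str sub])
  qed
  \<comment> \<open>As \<open>P k\<close> is a group homomorphism, this quotient has trivial
    component in the factor \<open>k\<close>. It is thus a sum of directions of invariance, and
    \<open>x\<close> is \<open>P k x\<close> translated by it on the right.\<close>
  let ?w = "mul (- P k x) x"
  have "P k (- P k x) = - P k x"
    using linear_neg[OF linear_projection[OF k]] projection_projection[OF k] by simp
  then have Pw: "P k ?w = 0"
    by (simp only: projection_mul[OF k] minus_left)
  have "P j ?w \<in> ?H" if j: "j \<in> {1..m}" for j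
  proof (cases "j = k")
    case True
    then show ?thesis
      using Pw subspace_0[OF sub] by simp
  next
    case False
    then show ?thesis
      using VH[OF j] component_in[OF factors UNIV_I j] by blast
  qed
  then have "(\<Sum>j=1..m. P j ?w) \<in> ?H"
    by (rule subspace_sum[OF sub])
  then have "?w \<in> ?H"
    by (simp only: sum_component[OF factors UNIV_I])
  from invariance_algebra_invariant[OF \<phi>_diff this, of "P k x"] show ?thesis
    by (simp only: cancel_left)
qed

section \<open>Ordered products over the factors\<close>

lemma factor_in_carrier: "p \<in> factor G V k \<Longrightarrow> p \<in> carrier G \<and> Log G p \<in> V k"
  by (auto simp: factor_def)

text \<open>Projections are group homomorphisms, so a new factor changes only its own component; the
  components not yet multiplied in are still 0.\<close>

lemma ordered_prod_projection:
  assumes "\<And>j. j \<in> {1..m} \<Longrightarrow> q j \<in> factor G V j" "n \<le> m"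
  shows "ordered_prod G q n \<in> carrier G \<and>
    (\<forall>k\<in>{1..m}. P k (Log G (ordered_prod G q n)) = (if k \<le> n then Log G (q k) else 0))"
  using assms(2)
proof (induction n)
  case 0
  interpret group G by (rule group)
  show ?case
    using linear_0[OF linear_projection] by simp
next
  case (Suc n)
  interpret group G by (rule group)
  have IH: "ordered_prod G q n \<in> carrier G"
      "\<And>k. k \<in> {1..m} \<Longrightarrow> P k (Log G (ordered_prod G q n)) = (if k \<le> n then Log G (q k) else 0)"
    using Suc by auto
  have n: "Suc n \<in> {1..m}"
    using Suc.prems by simp
  have q: "q (Suc n) \<in> carrier G" "Log G (q (Suc n)) \<in> V (Suc n)"
    using factor_in_carrier assms(1)[OF n] by auto
  have "Log G (ordered_prod G q (Suc n)) = mul (Log G (ordered_prod G q n)) (Log G (q (Suc n)))"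
    using IH(1) q(1) by (simp add: mul_def)
  then have "P k (Log G (ordered_prod G q (Suc n))) = (if k \<le> Suc n then Log G (q k) else 0)"
    if k: "k \<in> {1..m}" for k
    using IH(2)[OF k] component_of_summand[OF factors q(2) n k]
    by (simp only: projection_mul[OF k]) (auto simp: le_Suc_eq)
  then show ?case
    using IH(1) q(1) by simp
qed

lemma product_form_of_components:
  assumes F: "F \<in> carrier G \<rightarrow> carrier G"
    and comp: "\<And>k x. k \<in> {1..m} \<Longrightarrow> P k (chart_map F x) = P k (chart_map F (P k x))"
  shows "product_form G m V (\<lambda>j. Exp G \<circ> P j \<circ> Log G \<circ> F) F"
  unfolding product_form_def
proof (intro conjI ballI allI impI)
  \<comment> \<open>The map of the factor \<open>j\<close> is \<open>F\<close> followed by the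
    projection back to that factor. The product form is then verified one component at a
    time.\<close>
  let ?f = "\<lambda>j. Exp G \<circ> P j \<circ> Log G \<circ> F"
  have f: "?f j p \<in> factor G V j" if "j \<in> {1..m}" for j p
    using component_in[OF factors UNIV_I that] by (simp add: factor_def)
  then show "?f j \<in> factor G V j \<rightarrow> factor G V j" if "j \<in> {1..m}" for j
    using that by blast
  fix q assume "\<forall>j\<in>{1..m}. q j \<in> factor G V j"
  then have q: "q j \<in> factor G V j" if "j \<in> {1..m}" for j
    using that by blast
  define x where "x = Log G (ordered_prod G q m)"
  have x: "ordered_prod G q m = Exp G x" "\<And>k. k \<in> {1..m} \<Longrightarrow> P k x = Log G (q k)"
    using ordered_prod_projection[OF q order_refl] by (simp_all add: x_def)
  have fq: "?f j (q j) \<in> factor G V j" if "j \<in> {1..m}" for j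
    using f[OF that] .
  note r = ordered_prod_projection[OF fq order_refl]
  have "Log G (F (ordered_prod G q m)) = Log G (ordered_prod G (\<lambda>j. ?f j (q j)) m)"
  proof (rule component_eqI[OF factors])
    fix k assume k: "k \<in> {1..m}"
    have qk: "q k = Exp G (Log G (q k))"
      using factor_in_carrier[OF q[OF k]] by simp
    have "P k (Log G (F (ordered_prod G q m))) = P k (chart_map F x)"
      by (simp add: x(1) chart_map_def)
    also have "\<dots> = P k (chart_map F (Log G (q k)))"
      using comp[OF k, of x] x(2)[OF k] by simp
    also have "\<dots> = P k (Log G (F (q k)))"
      using qk by (simp add: chart_map_def)
    also have "\<dots> = P k (Log G (ordered_prod G (\<lambda>j. ?f j (q j)) m))"
      using r k by simp
    finally show "P k (Log G (F (ordered_prod G q m))) = P k (Log G (ordered_prod G (\<lambda>j. ?f j (q j)) m))" .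
  qed
  moreover have "F (ordered_prod G q m) \<in> carrier G"
    using F x(1) by (simp add: Pi_iff)
  ultimately show "F (ordered_prod G q m) = ordered_prod G (\<lambda>j. ?f j (q j)) m"
    using r by (metis (no_types, lifting) Exp_Log)
qed

end

theorem theorem5p5:
  fixes G :: "('p, 'g::euclidean_space) stratified_data"
    and d :: "'p \<Rightarrow> 'p \<Rightarrow> real"
    and m :: nat and V :: "nat \<Rightarrow> 'g set"
    and r :: "nat \<Rightarrow> nat" and X Y :: "nat \<Rightarrow> nat \<Rightarrow> 'g" and U :: "nat \<Rightarrow> 'g"
    and J :: "'g \<Rightarrow> 'g" and f :: "'p \<Rightarrow> 'p"
  assumes "carnot_group G d"
    and "totally_nonabelian (brak G) UNIV (layer G)"
    and "finest_decomposition (brak G) UNIV (layer G) (step G) m V"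
    and "m > 1"
    and "\<And>k. k \<in> {1..m} \<Longrightarrow> tight (brak G) (V k) (\<lambda>j. layer G j \<inter> V k)"
    and "\<And>k. k \<in> {1..m} \<Longrightarrow>
           tight_basis (brak G) (\<lambda>j. layer G j \<inter> V k) (r k) (X k) (Y k) (U k)"
    and "\<And>k. k \<in> {1..m} \<Longrightarrow> almost_complex_structure J (r k) (X k) (Y k)"
    and "cr_mapping G J (carrier G) (carrier G) f"
  shows "\<exists>T F fs. permutes_factors G m V T \<and>
           cr_mapping G J (carrier G) (carrier G) F \<and> product_form G m V fs F \<and>
           (\<forall>p\<in>carrier G. f p = T (F p))"
proof -
  interpret factored_chart G m V
    using assms(1,3) by unfold_locales (simp_all add: carnot_group_def)
  have dom: "group_domain G (carrier G)" and diffeo: "group_diffeo G (carrier G) (carrier G) f"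
    and pansu: "\<And>p. p \<in> carrier G \<Longrightarrow> \<exists>D. has_pansu_derivative G f p D \<and>
        chart_map D \<in> lie_aut_dil G \<and> (\<forall>x\<in>layer G 1. chart_map D (J x) = J (chart_map D x))"
    using assms(8) by (simp_all add: cr_mapping_def Let_def chart_map_def)
  have bij_f: "bij_betw f (carrier G) (carrier G)"
    and smooth_f: "smooth_on UNIV (chart_map f)"
    and smooth_f': "smooth_on UNIV (chart_map (inv_into (carrier G) f))"
    using diffeo by (simp_all add: group_diffeo_def chart_map_def)
  have f: "f \<in> carrier G \<rightarrow> carrier G"
    using bij_f by (rule bij_betw_imp_funcset)
  have "\<forall>p. \<exists>D. has_pansu_derivative G f (Exp G p) D \<and>
        chart_map D \<in> lie_aut_dil G \<and> (\<forall>x\<in>layer G 1. chart_map D (J x) = J (chart_map D x))"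
    using pansu by simp
  then obtain D where D: "\<And>p. has_pansu_derivative G f (Exp G p) (D p)"
      "\<And>p. chart_map (D p) \<in> lie_aut_dil G"
      "\<And>p x. x \<in> layer G 1 \<Longrightarrow> chart_map (D p) (J x) = J (chart_map (D p) x)"
    by metis
  define A where "A p = chart_map (D p)" for p
  have A: "A p \<in> lie_aut_dil G" for p
    using D(2) by (simp add: A_def)
  have AJ: "A p (J x) = J (A p x)" if "x \<in> layer G 1" for p x
    using D(3)[OF that] by (simp add: A_def)
  have lin_A: "linear (A p)" and inj_A: "inj (A p)" for p
    using A[of p] by (simp_all add: lie_aut_dil_def bij_is_inj)
  have D_in: "D p \<in> carrier G \<rightarrow> carrier G"
    and lim: "\<And>K. compact K \<Longrightarrow> uniform_limit K
       (\<lambda>s x. dil G (1 / s) (mul (- chart_map f p) (chart_map f (mul p (dil G s x))))) (A p) (at_right 0)" for p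
    using D(1)[of p] unfolding has_pansu_derivative_chart[OF f] A_def by blast+
  note diff_f = smooth_on_differentiable[OF smooth_f]
  have left_diff_f: "left_diff (chart_map f) p y = A p y" if y: "y \<in> layer G 1" for p y
  proof (rule left_diff_eq_pansu[OF diff_f _ y lie_aut_first_layer[OF A y]])
    show "((\<lambda>s. dil G (1 / s) (mul (- chart_map f p) (chart_map f (mul p (dil G s y))))) \<longlongrightarrow> A p y) (at_right 0)"
      \<comment> \<open>A singleton is compact, so the uniform limit specialises to a pointwise
        one.\<close>
      by (rule tendsto_uniform_limitI[OF lim[of "{y}" p]]) auto
  qed
  have "\<forall>p. \<exists>\<sigma>. \<sigma> permutes {1..m} \<and> (\<forall>k\<in>{1..m}. A p ` V k = V (\<sigma> k))"
    using lie_aut_permutes[OF A] by metis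
  then obtain \<sigma> where \<sigma>: "\<And>p. \<sigma> p permutes {1..m}" "\<And>p k. k \<in> {1..m} \<Longrightarrow> A p ` V k = V (\<sigma> p k)"
    by metis
  \<comment> \<open>\<open>A\<close> was chosen separately at each point; its continuity comes from
    the ordinary differential of the smooth map \<open>f\<close>.\<close>
  have cont_A: "continuous_on UNIV (\<lambda>p. A p y)" if "y \<in> layer G 1" for y
    using continuous_left_diff[OF smooth_f, of y] left_diff_f[OF that] by simp
  have \<sigma>_const: "\<sigma> p k = \<sigma> 0 k" if "k \<in> {1..m}" for p k
    by (rule permutation_constant[OF \<sigma>(1,2) lin_A inj_A cont_A that])
  obtain B where B: "B \<in> lie_aut_dil G" "\<And>x. B (A 0 x) = x" "\<And>x. A 0 (B x) = x"
    using lie_aut_inverse[OF A] by blast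
  note bl_B = lie_aut_bounded_linear[OF B(1)]
  define T where "T = Exp G \<circ> A 0 \<circ> Log G"
  define F where "F = Exp G \<circ> B \<circ> Log G \<circ> f"
  have F: "F \<in> carrier G \<rightarrow> carrier G"
    by (simp add: F_def)
  have chart_F: "chart_map F = (\<lambda>x. B (chart_map f x))"
    by (simp add: F_def chart_map_def fun_eq_iff)
  have TF: "f p = T (F p)" if "p \<in> carrier G" for p
    using f that by (simp add: T_def F_def B(3) Pi_iff)
  have "T ` factor G V j = factor G V (\<sigma> 0 j)" if "j \<in> {1..m}" for j
    by (simp add: T_def factor_def image_image flip: \<sigma>(2)[OF that])
  then have perm: "permutes_factors G m V T"
    unfolding permutes_factors_def T_def using group_aut_of_lie_aut[OF A] \<sigma>(1) by blast
  have diff_F: "chart_map F differentiable (at p)" for p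
    unfolding chart_F using bounded_linear.has_derivative[OF bl_B] diff_f
    by (metis differentiable_def)
  \<comment> \<open>\<open>B\<close> is a group homomorphism commuting with dilations of positive
    factor, so the difference quotient of \<open>F\<close> is the image under \<open>B\<close> of
    that of \<open>f\<close>.\<close>
  have pansu_lim: "uniform_limit K
      (\<lambda>s x. dil G (1 / s) (mul (- chart_map F p) (chart_map F (mul p (dil G s x)))))
      (\<lambda>x. B (A p x)) (at_right 0)" if K: "compact K" for K p
  proof -
    have "uniform_limit K
      (\<lambda>s x. B (dil G (1 / s) (mul (- chart_map f p) (chart_map f (mul p (dil G s x))))))
      (\<lambda>x. B (A p x)) (at_right 0)"
      by (rule bounded_linear.uniform_limit[OF bl_B lim[OF K]])
    moreover have "B (dil G (1 / s) (mul (- chart_map f p) (chart_map f (mul p (dil G s x)))))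
        = dil G (1 / s) (mul (- chart_map F p) (chart_map F (mul p (dil G s x))))" if "s > 0" for s x
    proof -
      have "B (dil G (1 / s) z) = dil G (1 / s) (B z)" for z
        using B(1) that by (simp add: lie_aut_dil_def)
      then show ?thesis
        using linear_neg[OF bounded_linear.linear[OF bl_B]] by (simp add: chart_F lie_aut_mul[OF B(1)])
    qed
    then have "\<forall>\<^sub>F s in at_right 0. \<forall>x\<in>K.
        B (dil G (1 / s) (mul (- chart_map f p) (chart_map f (mul p (dil G s x)))))
        = dil G (1 / s) (mul (- chart_map F p) (chart_map F (mul p (dil G s x))))"
      by (simp add: eventually_at_filter)
    ultimately show ?thesis
      by (rule uniform_limit_cong[THEN iffD1, rotated -1]) simp_all
  qed
  have left_diff_F: "left_diff (chart_map F) p y = B (A p y)" if y: "y \<in> layer G 1" for p y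
  proof (rule left_diff_eq_pansu[OF diff_F _ y lie_aut_first_layer[OF B(1) lie_aut_first_layer[OF A y]]])
    show "((\<lambda>s. dil G (1 / s) (mul (- chart_map F p) (chart_map F (mul p (dil G s y))))) \<longlongrightarrow> B (A p y)) (at_right 0)"
      by (rule tendsto_uniform_limitI[OF pansu_lim[of "{y}" p]]) auto
  qed
  have "product_form G m V (\<lambda>j. Exp G \<circ> P j \<circ> Log G \<circ> F) F"
  proof (rule product_form_of_components[OF F factor_component[OF diff_F]])
    fix p j y assume j: "j \<in> {1..m}" and y: "y \<in> V j" "y \<in> layer G 1"
    \<comment> \<open>Since \<open>A p\<close> and \<open>A 0\<close> induce the same permutation,
      \<open>B\<close> brings the image of \<open>V j\<close> back to \<open>V j\<close>.\<close>
    have "A p ` V j = A 0 ` V j"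
      by (simp only: \<sigma>(2)[OF j] \<sigma>_const[OF j, of p])
    then obtain z where "z \<in> V j" "A p y = A 0 z"
      using y(1) by blast
    then show "left_diff (chart_map F) p y \<in> V j"
      by (simp add: B(2) left_diff_F[OF y(2)])
  qed
  moreover have "cr_mapping G J (carrier G) (carrier G) F"
  proof -
    have inj: "inj_on F (carrier G)"
    proof (rule inj_onI)
      fix p q assume "p \<in> carrier G" "q \<in> carrier G" "F p = F q"
      then show "p = q"
        using TF bij_f by (metis bij_betw_def inj_onD)
    qed
    \<comment> \<open>The inverse of \<open>F\<close> is \<open>T\<close> followed by the inverse of
      \<open>f\<close>, smooth because \<open>T\<close> is linear in the chart.\<close>
    have F_inverse: "F (inv_into (carrier G) f (Exp G (A 0 x))) = Exp G x" for x
      using bij_f by (simp add: F_def bij_betw_def f_inv_into_f B(2))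
    have inv_in: "inv_into (carrier G) f (Exp G (A 0 x)) \<in> carrier G" for x
      using bij_f by (simp add: bij_betw_def inv_into_into)
    have "bij_betw F (carrier G) (carrier G)"
      unfolding bij_betw_def
    proof
      have "p \<in> F ` carrier G" if "p \<in> carrier G" for p
        using F_inverse[of "Log G p"] inv_in[of "Log G p"] that by (metis Exp_Log image_eqI)
      then show "F ` carrier G = carrier G"
        using F by blast
    qed (rule inj)
    moreover have "smooth_on UNIV (chart_map F)"
      using smooth_f unfolding smooth_on_def chart_F
      by (blast intro: times_differentiable_on_linear_compose[OF bl_B])
    moreover have "chart_map (inv_into (carrier G) F) = (\<lambda>x. chart_map (inv_into (carrier G) f) (A 0 x))"
      using inv_into_f_eq[OF inj inv_in F_inverse] by (simp add: chart_map_def fun_eq_iff)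
    then have "smooth_on UNIV (chart_map (inv_into (carrier G) F))"
      using smooth_f' unfolding smooth_on_def
      by (auto intro: times_differentiable_on_compose_linear[OF lie_aut_bounded_linear[OF A]])
    ultimately have "group_diffeo G (carrier G) (carrier G) F"
      by (simp add: group_diffeo_def chart_map_def)
    moreover have "\<exists>Df. has_pansu_derivative G F p Df \<and> chart_map Df \<in> lie_aut_dil G \<and>
        (\<forall>x\<in>layer G 1. chart_map Df (J x) = J (chart_map Df x))" if p: "p \<in> carrier G" for p
    proof -
      define q where "q = Log G p"
      \<comment> \<open>A graded automorphism is its own Pansu differential, so the chain rule
        dictates this candidate.\<close>
      define E where "E = Exp G \<circ> (\<lambda>x. B (A q x)) \<circ> Log G"
      have E: "chart_map E = (\<lambda>x. B (A q x))"
        by (simp add: E_def chart_map_def fun_eq_iff)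
      have "has_pansu_derivative G F (Exp G q) E"
        unfolding has_pansu_derivative_chart[OF F] E using pansu_lim by (simp add: E_def)
      \<comment> \<open>The relation for \<open>A 0\<close> is used at \<open>B z\<close>, which
        lies in the first layer, and then \<open>B\<close> is applied.\<close>
      moreover have "B (J z) = J (B z)" if z: "z \<in> layer G 1" for z
        using AJ[OF lie_aut_first_layer[OF B(1) z], of 0] B(2,3) by metis
      ultimately show ?thesis
        using p lie_aut_compose[OF A B(1)] AJ lie_aut_first_layer[OF A]
        by (intro exI[of _ E]) (simp add: E q_def)
    qed
    ultimately show ?thesis
      using dom by (simp add: cr_mapping_def Let_def chart_map_def)
  qed
  ultimately show ?thesis
    using perm TF by blast
qed

end
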